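(* Let $\alpha_1<1/2$ and $\rho>\rho_c$. Then only the ground state is macroscopically occupied (BEC of type I): $$\lim_{V\to\infty}\frac1V\langle N_{\mathbf{n}}\rangle^C_V(\rho)=\begin{cases}\rho-\rho_c,&\mathbf{n}=(1,1,1),\\0,&\mathbf{n}\neq(1,1,1).\end{cases}$$
   Context: Fix exponents $\alpha_1\ge\alpha_2\ge\alpha_3>0$ with $\alpha_1+\alpha_2+\alpha_3=1$ and $\Lambda_V=\{x\in\mathbb{R}^3:0\le x_j\le V^{\alpha_j}\}$. The one-particle Hamiltonian $-\Delta/2$ on $L^2(\Lambda_V)$ with Dirichlet boundary conditions has eigenvalues $\epsilon_{\mathbf{n},V}=\frac{\pi^2}{2}\sum_jn_j^2V^{-2\alpha_j}$, $\mathbf{n}\in\mathbb{N}^3$, $n_j\ge1$; $N_{\mathbf{n}}$ is the occupation number of the eigenstate indexed by $\mathbf{n}$. Perfect Bose gas at inverse temperature $\beta>0$; canonical state at density $\rho=N/V$: $\langle\cdot\rangle^C_V(\rho)=Z_V(N)^{-1}\mathrm{Tr}(\cdot\,e^{-\beta T_V^{(N)}})$ on the symmetric $N$-particle space; limit at fixed $\rho$: $N$ particles in volume $V=N/\rho$, $N\to\infty$. $F(\eta)=\frac{\sqrt2}{3\pi^2}\eta^{3/2}$, $\rho_c=\int_0^\infty(e^{\beta\eta}-1)^{-1}F(d\eta)$. *)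

theory Defs
  imports "HOL-Analysis.Analysis"
begin

type_synonym mode = "nat \<times> nat \<times> nat"

text \<open>Index set of the Dirichlet eigenstates: n = (n1,n2,n3) with n_j >= 1.\<close>
definition modes :: "mode set" where
  "modes = {(n1, n2, n3). 1 \<le> n1 \<and> 1 \<le> n2 \<and> 1 \<le> n3}"

text \<open>One-particle eigenvalues of -Delta/2 with Dirichlet b.c. in the box
  [0,V^a1] x [0,V^a2] x [0,V^a3].\<close>
definition eps :: "real \<Rightarrow> real \<Rightarrow> real \<Rightarrow> real \<Rightarrow> mode \<Rightarrow> real" where
  "eps a1 a2 a3 V n = (case n of (n1, n2, n3) \<Rightarrow>
     pi^2 / 2 * (real n1 ^ 2 * V powr (-2 * a1) + real n2 ^ 2 * V powr (-2 * a2)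
                 + real n3 ^ 2 * V powr (-2 * a3)))"

text \<open>Occupation-number basis of the symmetric N-particle space:
  finitely supported occupation functions on the modes with total occupation N.\<close>
definition configs :: "nat \<Rightarrow> (mode \<Rightarrow> nat) set" where
  "configs N = {m. finite {k. m k \<noteq> 0} \<and> {k. m k \<noteq> 0} \<subseteq> modes
                   \<and> (\<Sum>k\<in>{k. m k \<noteq> 0}. m k) = N}"

definition energy :: "(mode \<Rightarrow> real) \<Rightarrow> (mode \<Rightarrow> nat) \<Rightarrow> real" where
  "energy e m = (\<Sum>k\<in>{k. m k \<noteq> 0}. real (m k) * e k)"

text \<open>Canonical partition function Z_V(N) = Tr exp(-beta T_V^(N)).\<close>
definition Zcan :: "real \<Rightarrow> (mode \<Rightarrow> real) \<Rightarrow> nat \<Rightarrow> real" where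
  "Zcan \<beta> e N = infsum (\<lambda>m. exp (- \<beta> * energy e m)) (configs N)"

definition occ_can :: "real \<Rightarrow> (mode \<Rightarrow> real) \<Rightarrow> nat \<Rightarrow> mode \<Rightarrow> real" where
  "occ_can \<beta> e N n =
     infsum (\<lambda>m. real (m n) * exp (- \<beta> * energy e m)) (configs N) / Zcan \<beta> e N"

text \<open>F(eta) = sqrt 2/(3 pi^2) eta^(3/2); F(d eta) = F'(eta) d eta.\<close>
definition Fdens :: "real \<Rightarrow> real" where
  "Fdens \<eta> = sqrt 2 / (3 * pi^2) * (3/2) * sqrt \<eta>"

definition rho_c :: "real \<Rightarrow> real" where
  "rho_c \<beta> = (LINT \<eta>:{0<..}|lborel. (1 / (exp (\<beta> * \<eta>) - 1)) * Fdens \<eta>)"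

end

theory Submission
  imports Defs "HOL-Probability.Distributions" "HOL-Real_Asymp.Real_Asymp"
begin

text \<open>
  Measure energies from the ground state. Adding a ground-state particle costs nothing, so the
  canonical partition function \<open>Z\<close> increases, and its increment at \<open>n\<close> is the weight of having \<open>n\<close>
  excited particles: their canonical law is the grand-canonical one at the critical chemical
  potential, conditioned to be at most \<open>N\<close>. Counting particles mode by mode shows that the
  increments satisfy Panjer's recursion, with the sums \<open>S j\<close> of the \<open>Suc j\<close>-th powers of the excited
  Boltzmann factors as coefficients. Hence the unconditioned law is compound Poisson with mean
  \<open>\<Sum>j. S j\<close> and variance \<open>\<Sum>j. Suc j * S j\<close>. The variance is at most the mean times \<open>1 + 1 / \<gamma>\<close>,
  where \<open>\<gamma>\<close> is \<open>\<beta>\<close> times the spectral gap, and every excited mode holds at most \<open>1 / \<gamma>\<close> particles.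
  For \<open>a1 < 1/2\<close> the bound \<open>1 / \<gamma>\<close> is \<open>o(V)\<close>, so by Chebyshev's inequality the conditioning does not
  change the mean to leading order. Finally \<open>S j\<close> factorises into three one-dimensional theta sums;
  comparing these with Gaussian integrals gives \<open>S j / V \<longlonglongrightarrow> (2 * pi * \<beta> * Suc j) powr (- (3/2))\<close>,
  and dominated convergence shows that the mean divided by \<open>V\<close> tends to \<open>rho_c \<beta>\<close>.
\<close>

section \<open>Compound Poisson weights\<close>

text \<open>The equation \<open>recursion\<close> is Panjer's recursion for a multiple of a compound Poisson law; the
  rate of jumps of size \<open>Suc j\<close> is \<open>S j / real (Suc j)\<close>, whence the mean and the variance below.\<close>
locale compound_poisson_weights =
  fixes w S :: "nat \<Rightarrow> real"
  assumes weight_nonneg: "w n \<ge> 0"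
    and jump_nonneg: "S j \<ge> 0"
    and summable_second_moment: "summable (\<lambda>j. real (Suc j) * S j)"
    and recursion: "real n * w n = (\<Sum>j<n. S j * w (n - Suc j))"
begin

definition mean :: real where
  "mean = (\<Sum>j. S j)"

definition variance :: real where
  "variance = (\<Sum>j. real (Suc j) * S j)"

lemma jumps_sums_mean: "S sums mean"
  unfolding mean_def
proof (intro summable_sums summable_comparison_test'[OF summable_second_moment])
  fix j show "norm (S j) \<le> real (Suc j) * S j"
    using jump_nonneg[of j] by (simp add: algebra_simps)
qed

lemma jumps_sums_variance: "(\<lambda>j. real (Suc j) * S j) sums variance"
  unfolding variance_def using summable_second_moment by (rule summable_sums)

lemma mean_nonneg: "mean \<ge> 0"
  by (rule sums_le[OF _ sums_zero jumps_sums_mean]) (rule jump_nonneg)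

lemma recursion_Suc: "real (Suc n) * w (Suc n) = (\<Sum>j\<le>n. S j * w (n - j))"
  using recursion[of "Suc n"] by (simp add: lessThan_Suc_atMost)

lemma truncated_mean_le: "(\<Sum>n\<le>N. real n * w n) \<le> mean * (\<Sum>n\<le>N. w n)"
proof (cases N)
  case 0
  then show ?thesis using mean_nonneg weight_nonneg by simp
next
  case (Suc M)
  have "(\<Sum>n\<le>N. real n * w n) = (\<Sum>n\<le>M. \<Sum>j\<le>n. S j * w (n - j))"
    unfolding Suc sum.atMost_Suc_shift by (simp only: recursion_Suc)
  also have "\<dots> = (\<Sum>(j, n)\<in>{(j, n). j + n \<le> M}. S j * w n)"
    by (rule sum.triangle_reindex_eq[symmetric])
  also have "\<dots> \<le> (\<Sum>(j, n)\<in>{..N} \<times> {..N}. S j * w n)"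
    by (intro sum_mono2) (auto simp: Suc weight_nonneg jump_nonneg)
  also have "\<dots> = (\<Sum>j\<le>N. S j) * (\<Sum>n\<le>N. w n)"
    by (simp add: sum_product sum.cartesian_product)
  also have "\<dots> \<le> mean * (\<Sum>n\<le>N. w n)"
    using sum_le_suminf[of S "{..N}"] jumps_sums_mean jump_nonneg
    by (intro mult_right_mono sum_nonneg weight_nonneg) (auto simp: sums_iff)
  finally show ?thesis .
qed

text \<open>By Markov's inequality a fixed fraction of the truncated mass lies below \<open>mean + 1\<close>.\<close>
lemma summable_weights: "summable w"
proof -
  define M where "M = nat \<lceil>mean + 1\<rceil>"
  have M: "mean + 1 \<le> real M"
    unfolding M_def by linarith
  have "(\<Sum>n<N. w n) \<le> (mean + 1) * (\<Sum>n<M. w n)" for N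
  proof -
    have pointwise: "w n \<le> (real n - mean) * w n + (mean + 1) * (if n < M then w n else 0)" for n
    proof -
      have "1 \<le> real n - mean + (mean + 1) * (if n < M then 1 else 0)"
        using M mean_nonneg by auto
      from mult_right_mono[OF this weight_nonneg[of n]] show ?thesis
        by (auto simp: algebra_simps split: if_splits)
    qed
    have "(\<Sum>n<N. w n) \<le> (\<Sum>n\<le>N. w n)"
      by (rule sum_mono2) (auto simp: weight_nonneg)
    also have "\<dots> \<le> (\<Sum>n\<le>N. (real n - mean) * w n + (mean + 1) * (if n < M then w n else 0))"
      by (intro sum_mono pointwise)
    also have "\<dots> = ((\<Sum>n\<le>N. real n * w n) - mean * (\<Sum>n\<le>N. w n))
        + (mean + 1) * (\<Sum>n\<in>{..N} \<inter> {n. n < M}. w n)"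
      by (simp only: sum.distrib sum_subtractf left_diff_distrib sum_distrib_left[symmetric])
         (simp add: sum.If_cases)
    also have "\<dots> \<le> 0 + (mean + 1) * (\<Sum>n<M. w n)"
      using truncated_mean_le[of N] mean_nonneg
      by (intro add_mono mult_left_mono sum_mono2) (auto simp: weight_nonneg)
    finally show ?thesis by simp
  qed
  then show ?thesis
    by (intro summableI_nonneg_bounded) (auto simp: weight_nonneg)
qed

definition total :: real where
  "total = (\<Sum>n. w n)"

lemma weights_sums_total: "w sums total"
  unfolding total_def using summable_weights by (rule summable_sums)

lemma first_moment_sums: "(\<lambda>n. real n * w n) sums (mean * total)"
proof -
  have "(\<lambda>n. \<Sum>j\<le>n. S j * w (n - j)) sums (mean * total)"
    using Cauchy_product_sums[of S w] jumps_sums_mean weights_sums_total jump_nonneg weight_nonneg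
    by (simp add: sums_iff)
  then have "(\<lambda>n. real (Suc n) * w (Suc n)) sums (mean * total)"
    by (simp only: recursion_Suc)
  then show ?thesis by (subst (asm) sums_Suc_iff) simp
qed

lemma second_moment_sums: "(\<lambda>n. real n ^ 2 * w n) sums ((variance + mean ^ 2) * total)"
proof -
  have jump_part: "(\<lambda>n. \<Sum>j\<le>n. (real (Suc j) * S j) * w (n - j)) sums (variance * total)"
    using Cauchy_product_sums[of "\<lambda>j. real (Suc j) * S j" w] jumps_sums_variance
      weights_sums_total jump_nonneg weight_nonneg
    by (simp add: sums_iff abs_mult)
  have weight_part: "(\<lambda>n. \<Sum>j\<le>n. S j * (real (n - j) * w (n - j))) sums (mean * (mean * total))"
    using Cauchy_product_sums[of S "\<lambda>n. real n * w n"] jumps_sums_mean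
      first_moment_sums jump_nonneg weight_nonneg
    by (simp add: sums_iff abs_mult)
  have split: "(\<Sum>j\<le>n. (real (Suc j) * S j) * w (n - j)) + (\<Sum>j\<le>n. S j * (real (n - j) * w (n - j)))
      = real (Suc n) ^ 2 * w (Suc n)" for n
  proof -
    have "real (Suc n) ^ 2 * w (Suc n) = (\<Sum>j\<le>n. real (Suc n) * (S j * w (n - j)))"
      by (simp only: power2_eq_square mult.assoc recursion_Suc sum_distrib_left)
    also have "\<dots> = (\<Sum>j\<le>n. (real (Suc j) * S j) * w (n - j) + S j * (real (n - j) * w (n - j)))"
      by (rule sum.cong) (auto simp: of_nat_diff algebra_simps)
    finally show ?thesis by (simp add: sum.distrib)
  qed
  have "(\<lambda>n. real (Suc n) ^ 2 * w (Suc n)) sums ((variance + mean ^ 2) * total)"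
    using sums_add[OF jump_part weight_part] unfolding split
    by (simp add: power2_eq_square algebra_simps)
  then show ?thesis by (subst (asm) sums_Suc_iff) simp
qed

lemma variance_sums: "(\<lambda>n. (real n - mean) ^ 2 * w n) sums (variance * total)"
proof -
  have "(\<lambda>n. real n ^ 2 * w n - 2 * mean * (real n * w n) + mean ^ 2 * w n) sums
      ((variance + mean ^ 2) * total - 2 * mean * (mean * total) + mean ^ 2 * total)"
    by (intro sums_add sums_diff sums_mult second_moment_sums first_moment_sums weights_sums_total)
  then show ?thesis by (simp add: power2_eq_square algebra_simps)
qed

lemma index_le_square_deviation:
  assumes "mean < real N" "N \<le> n"
  shows "real n \<le> real N / (real N - mean) ^ 2 * (real n - mean) ^ 2"
proof -
  have "mean * mean \<le> real N * real n"
    using assms mean_nonneg by (intro mult_mono) auto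
  then have "0 \<le> (real n - real N) * (real N * real n - mean * mean)"
    using assms by simp
  also have "\<dots> = real N * (real n - mean) ^ 2 - real n * (real N - mean) ^ 2"
    by (simp add: power2_eq_square algebra_simps)
  finally show ?thesis using assms by (simp add: field_simps)
qed

lemma truncated_mean_ge:
  assumes "mean < real N"
  shows "(mean - real N * variance / (real N - mean) ^ 2) * (\<Sum>n\<le>N. w n) \<le> (\<Sum>n\<le>N. real n * w n)"
proof -
  define c where "c = real N / (real N - mean) ^ 2"
  have "mean * total \<le> (\<Sum>n\<le>N. real n * w n) + c * (variance * total)"
  proof (rule sums_le[OF _ first_moment_sums])
    show "(\<lambda>n. (if n \<in> {..N} then real n * w n else 0) + c * ((real n - mean) ^ 2 * w n))
        sums ((\<Sum>n\<le>N. real n * w n) + c * (variance * total))"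
      by (intro sums_add sums_mult variance_sums sums_If_finite_set) simp
    fix n
    show "real n * w n \<le> (if n \<in> {..N} then real n * w n else 0) + c * ((real n - mean) ^ 2 * w n)"
      using mult_right_mono[OF index_le_square_deviation[OF assms, of n] weight_nonneg[of n]]
        weight_nonneg[of n]
      by (auto simp: c_def mult.assoc not_le)
  qed
  then have tail: "(mean - c * variance) * total \<le> (\<Sum>n\<le>N. real n * w n)"
    by (simp add: algebra_simps)
  have "(mean - c * variance) * (\<Sum>n\<le>N. w n) \<le> (\<Sum>n\<le>N. real n * w n)"
  proof (cases "0 \<le> mean - c * variance")
    case True
    have "(\<Sum>n\<le>N. w n) \<le> total"
      unfolding total_def by (intro sum_le_suminf summable_weights) (auto simp: weight_nonneg)
    from mult_left_mono[OF this True] tail show ?thesis by linarith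
  next
    case False
    then have "(mean - c * variance) * (\<Sum>n\<le>N. w n) \<le> 0"
      by (simp add: mult_nonpos_nonneg sum_nonneg weight_nonneg)
    also have "0 \<le> (\<Sum>n\<le>N. real n * w n)" by (simp add: sum_nonneg weight_nonneg)
    finally show ?thesis .
  qed
  then show ?thesis by (simp add: c_def)
qed

end

lemma geometric_decay_moments:
  fixes S :: "nat \<Rightarrow> real"
  assumes nonneg: "\<And>j. S j \<ge> 0" and ratio: "\<And>j. S (Suc j) \<le> r * S j" and r: "0 \<le> r" "r < 1"
  shows "summable (\<lambda>j. real (Suc j) * S j)"
    and "(\<Sum>j. real (Suc j) * S j) \<le> (\<Sum>j. S j) / (1 - r)"
proof -
  have summable: "summable S"
    by (rule summable_ratio_test[where N = 0, OF r(2)]) (use nonneg ratio in auto)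
  have bound: "(\<Sum>j<n. real (Suc j) * S j) \<le> (\<Sum>j. S j) / (1 - r)" for n
  proof -
    have "(\<Sum>j<n. real (Suc j) * S j) \<le> (\<Sum>j<Suc n. real (Suc j) * S j)"
      by (rule sum_mono2) (auto simp: nonneg)
    also have "\<dots> = (\<Sum>j<Suc n. S j) + (\<Sum>j<Suc n. real j * S j)"
      by (simp add: sum.distrib algebra_simps)
    also have "(\<Sum>j<Suc n. S j) \<le> (\<Sum>j. S j)"
      by (intro sum_le_suminf summable) (auto simp: nonneg)
    also have "(\<Sum>j<Suc n. real j * S j) = (\<Sum>j<n. real (Suc j) * S (Suc j))"
      by (subst sum.lessThan_Suc_shift) simp
    also have "\<dots> \<le> (\<Sum>j<n. r * (real (Suc j) * S j))"
      using ratio by (intro sum_mono) (simp add: mult.left_commute[of r] mult_left_mono)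
    also have "\<dots> = r * (\<Sum>j<n. real (Suc j) * S j)"
      by (rule sum_distrib_left[symmetric])
    finally show ?thesis using r by (simp add: pos_le_divide_eq algebra_simps)
  qed
  show summable_moment: "summable (\<lambda>j. real (Suc j) * S j)"
    by (rule summableI_nonneg_bounded[OF _ bound]) (simp add: nonneg)
  show "(\<Sum>j. real (Suc j) * S j) \<le> (\<Sum>j. S j) / (1 - r)"
    by (rule suminf_le_const[OF summable_moment bound])
qed

definition increments :: "(nat \<Rightarrow> 'a :: minus) \<Rightarrow> nat \<Rightarrow> 'a" where
  "increments f n = (case n of 0 \<Rightarrow> f 0 | Suc m \<Rightarrow> f (Suc m) - f m)"

lemma increments_simps [simp]:
  "increments f 0 = f 0" "increments f (Suc n) = f (Suc n) - f n"
  by (simp_all add: increments_def)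

lemma sum_increments:
  fixes f :: "nat \<Rightarrow> 'a :: ab_group_add"
  shows "(\<Sum>n\<le>N. increments f n) = f N"
  by (induction N) auto

lemma sum_index_mult_increments:
  fixes f :: "nat \<Rightarrow> 'a :: ring_1"
  shows "(\<Sum>n\<le>N. of_nat n * increments f n) = of_nat N * f N - (\<Sum>n<N. f n)"
  by (induction N) (auto simp: algebra_simps)

lemma increments_recursion:
  fixes T S :: "nat \<Rightarrow> 'a :: ring_1"
  assumes recursion: "\<And>N. of_nat N * T N = (\<Sum>j<N. (1 + S j) * T (N - Suc j))"
  shows "of_nat n * increments T n = (\<Sum>j<n. S j * increments T (n - Suc j))"
proof (cases n)
  case (Suc m)
  have split: "of_nat N * T N = (\<Sum>j<N. T j) + (\<Sum>j<N. S j * T (N - Suc j))" for N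
    unfolding recursion by (simp add: distrib_right sum.distrib sum.nat_diff_reindex)
  have increment: "increments T (m - j) = T (m - j) - T (m - Suc j)" if "j < m" for j
    using increments_simps(2)[of T "m - Suc j"] that by (simp add: Suc_diff_Suc)
  have "of_nat n * increments T n = of_nat (Suc m) * T (Suc m) - of_nat m * T m - T m"
    by (simp add: Suc algebra_simps)
  also have "\<dots> = (\<Sum>j<m. S j * (T (m - j) - T (m - Suc j))) + S m * T 0"
    unfolding split by (simp add: sum_subtractf algebra_simps)
  also have "\<dots> = (\<Sum>j<m. S j * increments T (m - j)) + S m * increments T 0"
    by (simp add: increment)
  finally show ?thesis by (simp add: Suc)
qed simp

section \<open>Canonical occupation numbers\<close>

lemma has_sum_sum:
  fixes f :: "'i \<Rightarrow> 'a \<Rightarrow> 'b :: topological_comm_monoid_add"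
  assumes "\<And>i. i \<in> I \<Longrightarrow> (f i has_sum s i) A"
  shows "((\<lambda>x. \<Sum>i\<in>I. f i x) has_sum (\<Sum>i\<in>I. s i)) A"
  using assms by (induction I rule: infinite_finite_induct) (auto intro!: has_sum_add)

lemma has_sum_product_nonneg:
  fixes f :: "'a \<Rightarrow> real" and g :: "'b \<Rightarrow> real"
  assumes f: "(f has_sum a) A" and g: "(g has_sum b) B"
    and nonneg: "\<And>x. x \<in> A \<Longrightarrow> f x \<ge> 0" "\<And>y. y \<in> B \<Longrightarrow> g y \<ge> 0"
  shows "((\<lambda>(x, y). f x * g y) has_sum (a * b)) (A \<times> B)"
proof -
  have inner: "((\<lambda>y. (\<lambda>(x, y). f x * g y) (x, y)) has_sum (f x * b)) B" for x
    using has_sum_cmult_right[OF g, of "f x"] by simp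
  have outer: "((\<lambda>x. f x * b) has_sum (a * b)) A"
    by (rule has_sum_cmult_left[OF f])
  have "(\<lambda>(x, y). f x * g y) summable_on A \<times> B"
    by (rule summable_on_SigmaI[OF inner has_sum_imp_summable[OF outer]]) (use nonneg in auto)
  then show ?thesis by (rule has_sum_SigmaI[OF inner outer])
qed

lemma summable_on_image:
  fixes f :: "'b \<Rightarrow> 'c :: banach"
  assumes "(\<lambda>x. f (h x)) summable_on A"
  shows "f summable_on h ` A"
proof -
  define B where "B = inv_into A h ` h ` A"
  have "bij_betw (inv_into A h) (h ` A) B"
    unfolding B_def by (intro inj_on_imp_bij_betw inj_on_inv_into subset_refl)
  moreover have "(\<lambda>x. f (h x)) summable_on B"
    by (rule summable_on_subset_banach[OF assms]) (auto simp: B_def inv_into_into)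
  ultimately have "(\<lambda>y. f (h (inv_into A h y))) summable_on h ` A"
    using summable_on_reindex_bij_betw[where f = "\<lambda>x. f (h x)"] by blast
  then show ?thesis by (simp add: f_inv_into_f cong: summable_on_cong)
qed

lemma finite_support_config: "m \<in> configs N \<Longrightarrow> finite {k. m k \<noteq> 0}"
  by (simp add: configs_def)

lemma configs_0: "configs 0 = {\<lambda>_. 0}"
  by (auto simp: configs_def)

lemma configs_iff_superset:
  assumes "finite F" "{k. m k \<noteq> 0} \<subseteq> F"
  shows "m \<in> configs N \<longleftrightarrow> {k. m k \<noteq> 0} \<subseteq> modes \<and> (\<Sum>k\<in>F. m k) = N"
proof -
  have "(\<Sum>k\<in>{k. m k \<noteq> 0}. m k) = (\<Sum>k\<in>F. m k)"
    using assms by (intro sum.mono_neutral_left) auto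
  then show ?thesis using finite_subset[OF assms(2,1)] by (auto simp: configs_def)
qed

lemma energy_superset:
  assumes "finite F" "{k. m k \<noteq> 0} \<subseteq> F"
  shows "energy e m = (\<Sum>k\<in>F. real (m k) * e k)"
  unfolding energy_def using assms by (intro sum.mono_neutral_left) auto

lemma occupation_le:
  assumes "m \<in> configs N"
  shows "m k \<le> N"
proof (cases "m k = 0")
  case False
  then have "m k \<le> (\<Sum>k\<in>{k. m k \<noteq> 0}. m k)"
    using assms by (intro member_le_sum) (auto simp: configs_def)
  then show ?thesis using assms by (simp add: configs_def)
qed simp

definition add_particles :: "mode \<Rightarrow> nat \<Rightarrow> (mode \<Rightarrow> nat) \<Rightarrow> mode \<Rightarrow> nat" where
  "add_particles k j m = m(k := m k + j)"

lemma sum_add_particles: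
  fixes c :: "mode \<Rightarrow> 'a :: comm_semiring_1"
  assumes "finite F" "k \<in> F"
  shows "(\<Sum>l\<in>F. of_nat (add_particles k j m l) * c l) = (\<Sum>l\<in>F. of_nat (m l) * c l) + of_nat j * c k"
proof -
  have "(\<Sum>l\<in>F. of_nat (add_particles k j m l) * c l)
      = (\<Sum>l\<in>F. of_nat (m l) * c l + (if l = k then of_nat j * c k else 0))"
    by (intro sum.cong) (auto simp: add_particles_def algebra_simps)
  then show ?thesis using assms by (simp only: sum.distrib) simp
qed

lemma energy_add_particles:
  assumes "finite {k. m k \<noteq> 0}"
  shows "energy e (add_particles k j m) = energy e m + real j * e k"
proof -
  let ?F = "insert k {k. m k \<noteq> 0}"
  have "energy e (add_particles k j m) = (\<Sum>l\<in>?F. real (add_particles k j m l) * e l)"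
    using assms by (intro energy_superset) (auto simp: add_particles_def)
  also have "\<dots> = (\<Sum>l\<in>?F. real (m l) * e l) + real j * e k"
    using assms by (intro sum_add_particles) auto
  also have "(\<Sum>l\<in>?F. real (m l) * e l) = energy e m"
    using assms by (intro energy_superset[symmetric]) auto
  finally show ?thesis .
qed

lemma add_particles_in_configs_iff:
  assumes "k \<in> modes" "finite {k. m k \<noteq> 0}"
  shows "add_particles k j m \<in> configs (N + j) \<longleftrightarrow> m \<in> configs N"
proof -
  let ?F = "insert k {k. m k \<noteq> 0}"
  have "(\<Sum>l\<in>?F. add_particles k j m l) = (\<Sum>l\<in>?F. m l) + j"
    using sum_add_particles[of ?F k j m "\<lambda>_. 1 :: nat"] assms by simp
  moreover have "add_particles k j m \<in> configs (N + j) \<longleftrightarrow>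
      {l. add_particles k j m l \<noteq> 0} \<subseteq> modes \<and> (\<Sum>l\<in>?F. add_particles k j m l) = N + j"
    using assms by (intro configs_iff_superset) (auto simp: add_particles_def)
  moreover have "m \<in> configs N \<longleftrightarrow> {l. m l \<noteq> 0} \<subseteq> modes \<and> (\<Sum>l\<in>?F. m l) = N"
    using assms by (intro configs_iff_superset) auto
  ultimately show ?thesis using assms(1) by (auto simp: add_particles_def)
qed

lemma bij_betw_add_particles:
  assumes k: "k \<in> modes" and j: "j \<le> N"
  shows "bij_betw (add_particles k j) (configs (N - j)) {m \<in> configs N. j \<le> m k}"
proof (rule bij_betwI[where g = "\<lambda>m. m(k := m k - j)"])
  show "add_particles k j \<in> configs (N - j) \<rightarrow> {m \<in> configs N. j \<le> m k}"
  proof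
    fix m assume "m \<in> configs (N - j)"
    then show "add_particles k j m \<in> {m \<in> configs N. j \<le> m k}"
      using add_particles_in_configs_iff[OF k finite_support_config, of m "N - j" j "N - j"] j
      by (simp add: add_particles_def)
  qed
  show "(\<lambda>m. m(k := m k - j)) \<in> {m \<in> configs N. j \<le> m k} \<rightarrow> configs (N - j)"
  proof
    fix m assume m: "m \<in> {m \<in> configs N. j \<le> m k}"
    let ?m = "m(k := m k - j)"
    have "finite {l. ?m l \<noteq> 0}"
      by (rule finite_subset[of _ "{l. m l \<noteq> 0}"]) (use m finite_support_config in auto)
    moreover have "add_particles k j ?m = m" using m by (auto simp: add_particles_def)
    ultimately show "?m \<in> configs (N - j)"
      using add_particles_in_configs_iff[OF k, of ?m j "N - j"] m j by simp
  qed
qed (auto simp: add_particles_def)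

lemma configs_Suc: "configs (Suc N) = (\<lambda>(k, m). add_particles k 1 m) ` (modes \<times> configs N)"
proof -
  have occupied: "\<exists>k\<in>modes. 1 \<le> m k" if "m \<in> configs (Suc N)" for m
  proof -
    have "(\<Sum>k\<in>{k. m k \<noteq> 0}. m k) \<noteq> 0" using that by (simp add: configs_def)
    then have "{k. m k \<noteq> 0} \<noteq> {}" by (metis sum.empty)
    then show ?thesis using that by (fastforce simp: configs_def)
  qed
  have "add_particles k 1 ` configs N = {m \<in> configs (Suc N). 1 \<le> m k}" if "k \<in> modes" for k
    using bij_betw_imp_surj_on[OF bij_betw_add_particles[OF that, of 1 "Suc N"]] by simp
  then have "(\<Union>k\<in>modes. add_particles k 1 ` configs N) = (\<Union>k\<in>modes. {m \<in> configs (Suc N). 1 \<le> m k})"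
    by simp
  also have "\<dots> = configs (Suc N)" using occupied by blast
  finally show ?thesis by force
qed

lemma occ_can_shift: "occ_can \<beta> (\<lambda>k. e k - c) N n = occ_can \<beta> e N n"
proof -
  have boltzmann_shift:
    "exp (- \<beta> * energy (\<lambda>k. e k - c) m) = exp (\<beta> * c * real N) * exp (- \<beta> * energy e m)"
    if "m \<in> configs N" for m
  proof -
    have "real N = (\<Sum>k\<in>{k. m k \<noteq> 0}. real (m k))"
      using that by (auto simp: configs_def)
    then have "energy (\<lambda>k. e k - c) m = energy e m - c * real N"
      by (simp add: energy_def sum_subtractf sum_distrib_left algebra_simps)
    then show ?thesis by (simp add: right_diff_distrib flip: exp_add)
  qed
  have "Zcan \<beta> (\<lambda>k. e k - c) N = exp (\<beta> * c * real N) * Zcan \<beta> e N"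
    unfolding Zcan_def infsum_cmult_right'[symmetric] by (intro infsum_cong boltzmann_shift)
  moreover have "infsum (\<lambda>m. real (m n) * exp (- \<beta> * energy (\<lambda>k. e k - c) m)) (configs N)
     = exp (\<beta> * c * real N) * infsum (\<lambda>m. real (m n) * exp (- \<beta> * energy e m)) (configs N)"
    unfolding infsum_cmult_right'[symmetric] 
    by (intro infsum_cong) (simp only: boltzmann_shift mult.left_commute)
  ultimately show ?thesis by (simp add: occ_can_def)
qed

locale perfect_bose_gas =
  fixes \<beta> :: real and e :: "mode \<Rightarrow> real"
  assumes summable_factors: "(\<lambda>k. exp (- \<beta> * e k)) summable_on modes"
begin

abbreviation factor :: "mode \<Rightarrow> real" where
  "factor k \<equiv> exp (- \<beta> * e k)"

abbreviation boltzmann :: "(mode \<Rightarrow> nat) \<Rightarrow> real" where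
  "boltzmann m \<equiv> exp (- \<beta> * energy e m)"

abbreviation Z :: "nat \<Rightarrow> real" where
  "Z \<equiv> Zcan \<beta> e"

lemma boltzmann_add_particles:
  assumes "m \<in> configs N"
  shows "boltzmann (add_particles k j m) = factor k ^ j * boltzmann m"
  by (simp add: energy_add_particles[OF finite_support_config[OF assms]] algebra_simps
      flip: exp_add exp_of_nat_mult)

lemma boltzmann_summable_on_configs: "boltzmann summable_on configs N"
proof (induction N)
  case 0
  then show ?case by (simp add: configs_0)
next
  case (Suc N)
  have "(\<lambda>(k, m). factor k * boltzmann m) summable_on modes \<times> configs N"
    using has_sum_product_nonneg[OF has_sum_infsum[OF summable_factors] has_sum_infsum[OF Suc]]
    by (rule has_sum_imp_summable) auto
  then have "(\<lambda>p. boltzmann ((\<lambda>(k, m). add_particles k 1 m) p)) summable_on modes \<times> configs N"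
    by (rule summable_on_cong[THEN iffD1, rotated])
       (clarify, simp only: prod.case boltzmann_add_particles power_one_right)
  then show ?case unfolding configs_Suc by (rule summable_on_image[where f = boltzmann])
qed

lemma boltzmann_has_sum: "(boltzmann has_sum Z N) (configs N)"
  unfolding Zcan_def using boltzmann_summable_on_configs by (rule has_sum_infsum)

lemma Z_0: "Z 0 = 1"
  by (simp add: Zcan_def configs_0 energy_def)

lemma occupation_tail_has_sum:
  assumes k: "k \<in> modes" and j: "j \<le> N"
  shows "((\<lambda>m. if j \<le> m k then boltzmann m else 0) has_sum (factor k ^ j * Z (N - j))) (configs N)"
proof -
  have "((\<lambda>m. factor k ^ j * boltzmann m) has_sum (factor k ^ j * Z (N - j))) (configs (N - j))"
    by (intro has_sum_cmult_right boltzmann_has_sum)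
  also have "?this \<longleftrightarrow> ((\<lambda>m. boltzmann (add_particles k j m)) has_sum (factor k ^ j * Z (N - j)))
      (configs (N - j))"
    by (intro has_sum_cong) (simp only: boltzmann_add_particles)
  also have "\<dots> \<longleftrightarrow> (boltzmann has_sum (factor k ^ j * Z (N - j))) {m \<in> configs N. j \<le> m k}"
    by (rule has_sum_reindex_bij_betw[OF bij_betw_add_particles[OF k j]])
  also have "\<dots> \<longleftrightarrow> ?thesis"
    by (rule has_sum_cong_neutral) auto
  finally show ?thesis .
qed

lemma occupation_has_sum:
  assumes "k \<in> modes"
  shows "((\<lambda>m. real (m k) * boltzmann m) has_sum (\<Sum>j<N. factor k ^ Suc j * Z (N - Suc j)))
    (configs N)"
proof -
  have "((\<lambda>m. \<Sum>j<N. if Suc j \<le> m k then boltzmann m else 0) has_sum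
      (\<Sum>j<N. factor k ^ Suc j * Z (N - Suc j))) (configs N)"
    by (intro has_sum_sum occupation_tail_has_sum[OF assms]) auto
  also have "?this \<longleftrightarrow> ?thesis"
  proof (rule has_sum_cong)
    fix m assume "m \<in> configs N"
    then have "{..<N} \<inter> {j. Suc j \<le> m k} = {..<m k}"
      using occupation_le[of m N k] by auto
    then show "(\<Sum>j<N. if Suc j \<le> m k then boltzmann m else 0) = real (m k) * boltzmann m"
      by (simp add: sum.If_cases)
  qed
  finally show ?thesis .
qed

lemma occ_can_eq:
  assumes "k \<in> modes"
  shows "occ_can \<beta> e N k = (\<Sum>j<N. factor k ^ Suc j * Z (N - Suc j)) / Z N"
  unfolding occ_can_def using infsumI[OF occupation_has_sum[OF assms]] by simp

lemma Z_Suc_ge: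
  assumes "k \<in> modes"
  shows "factor k * Z N \<le> Z (Suc N)"
  using has_sum_mono[OF occupation_tail_has_sum[OF assms, of 1 "Suc N"] boltzmann_has_sum]
  by simp

lemma Z_pos: "Z N > 0"
proof (induction N)
  case (Suc N)
  have "0 < factor (1, 1, 1) * Z N" using Suc by simp
  also have "\<dots> \<le> Z (Suc N)" by (rule Z_Suc_ge) (simp add: modes_def)
  finally show ?case .
qed (simp add: Z_0)

lemma occ_can_nonneg:
  assumes "k \<in> modes"
  shows "0 \<le> occ_can \<beta> e N k"
  unfolding occ_can_eq[OF assms]
  by (intro divide_nonneg_pos sum_nonneg mult_nonneg_nonneg less_imp_le[OF Z_pos] Z_pos) simp

lemma total_occupation_has_sum:
  assumes "m \<in> configs N"
  shows "((\<lambda>k. real (m k)) has_sum real N) modes"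
proof -
  have "((\<lambda>k. real (m k)) has_sum real N) {k. m k \<noteq> 0}"
    using assms by (intro has_sum_finiteI) (auto simp: configs_def)
  then show ?thesis
    by (rule has_sum_cong_neutral[THEN iffD1, rotated -1]) (use assms in \<open>auto simp: configs_def\<close>)
qed

text \<open>Sum \<open>m k * boltzmann m\<close> over all modes and configurations in either order.\<close>
lemma Z_recursion:
  assumes power_sum: "\<And>j. ((\<lambda>k. factor k ^ Suc j) has_sum P j) modes"
  shows "real N * Z N = (\<Sum>j<N. P j * Z (N - Suc j))"
proof -
  define f where "f = (\<lambda>(m, k). real (m k) * boltzmann m)"
  have inner: "((\<lambda>k. f (m, k)) has_sum (real N * boltzmann m)) modes" if "m \<in> configs N" for m
    using has_sum_cmult_left[OF total_occupation_has_sum[OF that]] by (simp add: f_def)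
  have outer: "((\<lambda>m. real N * boltzmann m) has_sum (real N * Z N)) (configs N)"
    by (intro has_sum_cmult_right boltzmann_has_sum)
  have "f summable_on configs N \<times> modes"
    by (rule summable_on_SigmaI[OF inner has_sum_imp_summable[OF outer]]) (auto simp: f_def)
  from has_sum_SigmaI[OF inner outer this]
  have "((\<lambda>(k, m). f (m, k)) has_sum (real N * Z N)) (modes \<times> configs N)"
    by (simp add: has_sum_swap[of f])
  then have "((\<lambda>k. \<Sum>j<N. factor k ^ Suc j * Z (N - Suc j)) has_sum (real N * Z N)) modes"
    by (rule has_sum_SigmaD) (use occupation_has_sum in \<open>auto simp: f_def\<close>)
  moreover have "((\<lambda>k. \<Sum>j<N. factor k ^ Suc j * Z (N - Suc j)) has_sum
      (\<Sum>j<N. P j * Z (N - Suc j))) modes"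
    by (intro has_sum_sum has_sum_cmult_left power_sum)
  ultimately show ?thesis by (rule has_sum_unique)
qed

end

section \<open>Condensation in a gapped gas\<close>

text \<open>If \<open>e g = 0\<close>, the mean number of excited particles at chemical potential \<open>0\<close> is the sum of
  \<open>1 / (exp (\<beta> * e k) - 1)\<close> over \<open>k \<noteq> g\<close>, expanded below into geometric series.\<close>
definition excited_power_sum :: "real \<Rightarrow> (mode \<Rightarrow> real) \<Rightarrow> mode \<Rightarrow> nat \<Rightarrow> real" where
  "excited_power_sum \<beta> e g j = infsum (\<lambda>k. exp (- \<beta> * e k) ^ Suc j) (modes - {g})"

definition critical_number :: "real \<Rightarrow> (mode \<Rightarrow> real) \<Rightarrow> mode \<Rightarrow> real" where
  "critical_number \<beta> e g = (\<Sum>j. excited_power_sum \<beta> e g j)"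

locale gapped_bose_gas = perfect_bose_gas +
  fixes g :: mode and \<gamma> :: real
  assumes ground_mode: "g \<in> modes"
    and ground_energy: "e g = 0"
    and gap_pos: "\<gamma> > 0"
    and gap: "\<And>k. k \<in> modes \<Longrightarrow> k \<noteq> g \<Longrightarrow> \<gamma> \<le> \<beta> * e k"
begin

abbreviation S :: "nat \<Rightarrow> real" where
  "S \<equiv> excited_power_sum \<beta> e g"

lemma excited_factor_le: "k \<in> modes - {g} \<Longrightarrow> factor k \<le> exp (- \<gamma>)"
  using gap[of k] by simp

lemma excited_factors_summable: "(\<lambda>k. factor k ^ Suc j) summable_on (modes - {g})"
proof (rule summable_on_comparison_test)
  show "factor summable_on (modes - {g})"
    using summable_factors by (rule summable_on_subset_banach) simp
  fix k assume "k \<in> modes - {g}"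
  then have "factor k ^ j \<le> 1 ^ j"
    using gap[of k] gap_pos by (intro power_mono) auto
  then show "factor k ^ Suc j \<le> factor k" by simp
qed simp

lemma excited_power_sum_has_sum: "((\<lambda>k. factor k ^ Suc j) has_sum S j) (modes - {g})"
  unfolding excited_power_sum_def using excited_factors_summable by (rule has_sum_infsum)

lemma power_sum_has_sum: "((\<lambda>k. factor k ^ Suc j) has_sum (1 + S j)) modes"
proof -
  have "((\<lambda>k. factor k ^ Suc j) has_sum (factor g ^ Suc j + S j)) (insert g (modes - {g}))"
    by (intro has_sum_insert excited_power_sum_has_sum) simp
  then show ?thesis using ground_mode by (simp add: ground_energy insert_absorb)
qed

lemma excited_power_sum_nonneg: "S j \<ge> 0"
  by (rule has_sum_nonneg[OF excited_power_sum_has_sum]) simp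

lemma excited_power_sum_ratio: "S (Suc j) \<le> exp (- \<gamma>) * S j"
proof (rule has_sum_mono)
  show "((\<lambda>k. factor k ^ Suc (Suc j)) has_sum S (Suc j)) (modes - {g})"
    by (rule excited_power_sum_has_sum)
  show "((\<lambda>k. exp (- \<gamma>) * factor k ^ Suc j) has_sum (exp (- \<gamma>) * S j)) (modes - {g})"
    by (rule has_sum_cmult_right[OF excited_power_sum_has_sum])
  fix k assume "k \<in> modes - {g}"
  then show "factor k ^ Suc (Suc j) \<le> exp (- \<gamma>) * factor k ^ Suc j"
    unfolding power_Suc[of _ "Suc j"] by (intro mult_right_mono excited_factor_le) auto
qed

lemmas excited_moments =
  geometric_decay_moments[where S = S and r = "exp (- \<gamma>)",
    OF excited_power_sum_nonneg excited_power_sum_ratio]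

lemma Z_mono: "Z N \<le> Z (Suc N)"
  using Z_Suc_ge[OF ground_mode, of N] by (simp add: ground_energy)

sublocale compound_poisson_weights "increments Z" S
proof
  show "increments Z n \<ge> 0" for n
    using Z_mono Z_pos by (auto simp: increments_def less_imp_le split: nat.split)
  show "summable (\<lambda>j. real (Suc j) * S j)"
    using excited_moments(1) gap_pos by simp
  show "real n * increments Z n = (\<Sum>j<n. S j * increments Z (n - Suc j))" for n
    by (rule increments_recursion, rule Z_recursion[OF power_sum_has_sum])
qed (rule excited_power_sum_nonneg)

lemma mean_eq_critical_number: "mean = critical_number \<beta> e g"
  by (simp add: mean_def critical_number_def)

lemma inverse_one_minus_exp_le: "1 / (1 - exp (- \<gamma>)) \<le> 1 + 1 / \<gamma>"
proof -
  have "1 + \<gamma> \<le> exp \<gamma>" by (rule exp_ge_add_one_self)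
  then show ?thesis using gap_pos by (simp add: exp_minus field_simps)
qed

lemma variance_le: "variance \<le> critical_number \<beta> e g * (1 + 1 / \<gamma>)"
proof -
  have "variance \<le> mean * (1 / (1 - exp (- \<gamma>)))"
    using excited_moments(2) gap_pos by (simp add: variance_def mean_def)
  also have "\<dots> \<le> mean * (1 + 1 / \<gamma>)"
    by (intro mult_left_mono inverse_one_minus_exp_le mean_nonneg)
  finally show ?thesis by (simp add: mean_eq_critical_number)
qed

lemma ground_occupation_eq:
  "occ_can \<beta> e N g = real N - (\<Sum>n\<le>N. real n * increments Z n) / Z N"
proof -
  have "occ_can \<beta> e N g = (\<Sum>n<N. Z n) / Z N"
    by (simp add: occ_can_eq[OF ground_mode] ground_energy sum.nat_diff_reindex)
  then show ?thesis
    using Z_pos[of N] by (simp add: sum_index_mult_increments diff_divide_distrib)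
qed

lemma ground_occupation_ge: "real N - critical_number \<beta> e g \<le> occ_can \<beta> e N g"
  using truncated_mean_le[of N] Z_pos[of N]
  by (simp add: ground_occupation_eq sum_increments mean_eq_critical_number pos_divide_le_eq)

lemma ground_occupation_le:
  assumes "critical_number \<beta> e g < real N"
  shows "occ_can \<beta> e N g \<le> real N - critical_number \<beta> e g
    + real N * (critical_number \<beta> e g * (1 + 1 / \<gamma>)) / (real N - critical_number \<beta> e g) ^ 2"
proof -
  have "mean - real N * variance / (real N - mean) ^ 2 \<le> (\<Sum>n\<le>N. real n * increments Z n) / Z N"
    using truncated_mean_ge[of N] assms Z_pos[of N]
    by (simp add: sum_increments mean_eq_critical_number pos_le_divide_eq)
  moreover have "real N * variance / (real N - mean) ^ 2
      \<le> real N * (critical_number \<beta> e g * (1 + 1 / \<gamma>)) / (real N - mean) ^ 2"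
    by (intro divide_right_mono mult_left_mono variance_le) auto
  ultimately show ?thesis by (simp add: ground_occupation_eq mean_eq_critical_number)
qed

lemma excited_occupation_le:
  assumes "k \<in> modes" "k \<noteq> g"
  shows "occ_can \<beta> e N k \<le> 1 / \<gamma>"
proof -
  have "(\<Sum>j<N. factor k ^ Suc j * Z (N - Suc j)) \<le> (\<Sum>j<N. exp (- \<gamma>) ^ Suc j * Z N)"
    using assms excited_factor_le[of k] Z_pos lift_Suc_mono_le[of Z, OF Z_mono]
    by (intro sum_mono mult_mono power_mono) (auto simp: less_imp_le)
  also have "\<dots> = exp (- \<gamma>) * (\<Sum>j<N. exp (- \<gamma>) ^ j) * Z N"
    by (simp add: sum_distrib_left sum_distrib_right mult.assoc)
  also have "\<dots> \<le> 1 / \<gamma> * Z N"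
  proof (intro mult_right_mono less_imp_le[OF Z_pos])
    have "(\<Sum>j<N. exp (- \<gamma>) ^ j) \<le> 1 / (1 - exp (- \<gamma>))"
      using gap_pos sum_le_suminf[of "\<lambda>j. exp (- \<gamma>) ^ j" "{..<N}"]
      by (simp add: summable_geometric suminf_geometric)
    then have "exp (- \<gamma>) * (\<Sum>j<N. exp (- \<gamma>) ^ j) \<le> exp (- \<gamma>) * (1 / (1 - exp (- \<gamma>)))"
      by (rule mult_left_mono) simp
    also have "\<dots> = 1 / (1 - exp (- \<gamma>)) - 1"
      using gap_pos by (simp add: field_simps)
    also have "\<dots> \<le> 1 / \<gamma>" using inverse_one_minus_exp_le by simp
    finally show "exp (- \<gamma>) * (\<Sum>j<N. exp (- \<gamma>) ^ j) \<le> 1 / \<gamma>" .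
  qed
  finally show ?thesis
    using Z_pos[of N] by (simp add: occ_can_eq[OF assms(1)] pos_divide_le_eq)
qed

lemma ground_density_le:
  assumes V: "V > 0" and subcritical: "critical_number \<beta> e g / V < real N / V"
  shows "occ_can \<beta> e N g / V \<le> real N / V - critical_number \<beta> e g / V
    + (real N / V) * (critical_number \<beta> e g / V) / (real N / V - critical_number \<beta> e g / V) ^ 2
      * (1 / V + 1 / \<gamma> / V)"
proof -
  define c where "c = critical_number \<beta> e g / V"
  define d where "d = real N / V"
  define q where "q = 1 / V + 1 / \<gamma> / V"
  have scaled: "real N = V * d" "critical_number \<beta> e g = V * c" "1 + 1 / \<gamma> = V * q"
    using V by (simp_all add: c_def d_def q_def distrib_left)
  have "occ_can \<beta> e N g \<le> V * d - V * c + V * d * (V * c * (V * q)) / (V * d - V * c) ^ 2"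
    using ground_occupation_le[of N] subcritical V by (simp add: divide_less_cancel flip: scaled)
  also have "(V * d - V * c) ^ 2 = V ^ 2 * (d - c) ^ 2"
    by (simp add: power_mult_distrib flip: right_diff_distrib)
  also have "V * d * (V * c * (V * q)) / (V ^ 2 * (d - c) ^ 2) = V * (d * c / (d - c) ^ 2 * q)"
    using V by (simp add: power2_eq_square)
  also have "V * d - V * c + V * (d * c / (d - c) ^ 2 * q) = (d - c + d * c / (d - c) ^ 2 * q) * V"
    by (simp add: algebra_simps)
  finally show ?thesis
    using V unfolding c_def d_def q_def by (simp only: pos_divide_le_eq)
qed

end

lemma ground_density_tendsto:
  assumes gas: "eventually (\<lambda>N. gapped_bose_gas \<beta> (e N) g (\<gamma> N)) sequentially"
    and volume: "filterlim V at_top sequentially"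
    and density: "(\<lambda>N. real N / V N) \<longlonglongrightarrow> \<rho>"
    and critical: "(\<lambda>N. critical_number \<beta> (e N) g / V N) \<longlonglongrightarrow> \<rho>\<^sub>c" "\<rho>\<^sub>c < \<rho>"
    and gap: "(\<lambda>N. 1 / \<gamma> N / V N) \<longlonglongrightarrow> 0"
  shows "(\<lambda>N. occ_can \<beta> (e N) N g / V N) \<longlonglongrightarrow> \<rho> - \<rho>\<^sub>c"
proof (rule tendsto_sandwich)
  let ?c = "\<lambda>N. critical_number \<beta> (e N) g / V N" and ?d = "\<lambda>N. real N / V N"
  let ?upper = "\<lambda>N. ?d N - ?c N + ?d N * ?c N / (?d N - ?c N) ^ 2 * (1 / V N + 1 / \<gamma> N / V N)"
  have V_pos: "eventually (\<lambda>N. V N > 0) sequentially"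
    using volume by (auto simp: filterlim_at_top_dense)
  have subcritical: "eventually (\<lambda>N. ?c N < ?d N) sequentially"
    using order_tendstoD(1)[OF tendsto_diff[OF density critical(1)], of 0] critical(2) by simp
  show "eventually (\<lambda>N. ?d N - ?c N \<le> occ_can \<beta> (e N) N g / V N) sequentially"
    using gas V_pos
  proof eventually_elim
    case (elim N)
    from gapped_bose_gas.ground_occupation_ge[OF elim(1), of N] elim(2)
    show ?case by (simp add: divide_right_mono flip: diff_divide_distrib)
  qed
  show "eventually (\<lambda>N. occ_can \<beta> (e N) N g / V N \<le> ?upper N) sequentially"
    using gas V_pos subcritical by eventually_elim (rule gapped_bose_gas.ground_density_le)
  show "(\<lambda>N. ?d N - ?c N) \<longlonglongrightarrow> \<rho> - \<rho>\<^sub>c"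
    by (intro tendsto_diff density critical)
  have "(\<lambda>N. 1 / V N) \<longlonglongrightarrow> 0"
    by (rule tendsto_divide_0[OF tendsto_const filterlim_at_top_imp_at_infinity[OF volume]])
  then have "?upper \<longlonglongrightarrow> \<rho> - \<rho>\<^sub>c + \<rho> * \<rho>\<^sub>c / (\<rho> - \<rho>\<^sub>c) ^ 2 * (0 + 0)"
    using critical(2) by (intro tendsto_intros density critical(1) gap) auto
  then show "?upper \<longlonglongrightarrow> \<rho> - \<rho>\<^sub>c" by simp
qed

lemma excited_density_tendsto:
  assumes gas: "eventually (\<lambda>N. gapped_bose_gas \<beta> (e N) g (\<gamma> N)) sequentially"
    and volume: "filterlim V at_top sequentially"
    and gap: "(\<lambda>N. 1 / \<gamma> N / V N) \<longlonglongrightarrow> 0"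
    and k: "k \<in> modes" "k \<noteq> g"
  shows "(\<lambda>N. occ_can \<beta> (e N) N k / V N) \<longlonglongrightarrow> 0"
proof (rule tendsto_sandwich[OF _ _ tendsto_const gap])
  have V_pos: "eventually (\<lambda>N. V N > 0) sequentially"
    using volume by (auto simp: filterlim_at_top_dense)
  show "eventually (\<lambda>N. 0 \<le> occ_can \<beta> (e N) N k / V N) sequentially"
    using gas V_pos
    by eventually_elim
       (intro divide_nonneg_pos perfect_bose_gas.occ_can_nonneg k(1) gapped_bose_gas.axioms(1))
  show "eventually (\<lambda>N. occ_can \<beta> (e N) N k / V N \<le> 1 / \<gamma> N / V N) sequentially"
    using gas V_pos
    by eventually_elim
       (intro divide_right_mono gapped_bose_gas.excited_occupation_le[OF _ k] less_imp_le)
qed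

section \<open>Theta sums\<close>

lemma (in antimono_fun_sum_integral_diff) suminf_integral_bounds:
  assumes integral: "(\<lambda>n. integral {0..real n} f) \<longlonglongrightarrow> I"
  shows "summable (\<lambda>n. f (real n))"
    and "I \<le> (\<Sum>n. f (real n))"
    and "(\<Sum>n. f (real n)) \<le> I + f 0"
proof -
  show summable: "summable (\<lambda>n. f (real n))"
    using integral integral_test by (auto simp: convergent_def)
  have partial: "(\<lambda>n. \<Sum>k\<le>n. f (real k)) \<longlonglongrightarrow> (\<Sum>n. f (real n))"
    using summable by (rule summable_LIMSEQ')
  have "integral {0..real n} f \<le> (\<Sum>k\<le>n. f (real k))" for n
    using sum_integral_diff_series_nonneg[of n] by (simp add: sum_integral_diff_series_def)
  then show "I \<le> (\<Sum>n. f (real n))"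
    by (intro LIMSEQ_le[OF integral partial]) auto
  have "(\<Sum>k\<le>n. f (real k)) \<le> integral {0..real n} f + f 0" for n
    using sum_integral_diff_series_antimono[of 0 n] by (simp add: sum_integral_diff_series_def)
  then show "(\<Sum>n. f (real n)) \<le> I + f 0"
    by (intro LIMSEQ_le[OF partial tendsto_add[OF integral tendsto_const]]) auto
qed

lemma gaussian_half_line:
  fixes t :: real
  assumes t: "t > 0"
  shows "has_bochner_integral lborel (\<lambda>x. indicator {0..} x *\<^sub>R exp (- t * x\<^sup>2))
    (sqrt pi / (2 * sqrt t))"
proof -
  have "has_bochner_integral lborel
      (\<lambda>x. indicator {0..} (0 + sqrt t * x) *\<^sub>R exp (- (0 + sqrt t * x)\<^sup>2))
      ((sqrt pi / 2) /\<^sub>R \<bar>sqrt t\<bar>)"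
    using gaussian_moment_0 t by (subst lborel_has_bochner_integral_real_affine_iff[symmetric]) auto
  moreover have "indicator {0..} (0 + sqrt t * x) = (indicator {0..} x :: real)" for x
    using t by (auto simp: indicator_def zero_le_mult_iff)
  ultimately show ?thesis
    using t by (simp add: power_mult_distrib field_simps)
qed

lemma gaussian_integral_tendsto:
  fixes t :: real
  assumes "t > 0"
  shows "(\<lambda>n. integral {0..real n} (\<lambda>x. exp (- t * x\<^sup>2))) \<longlonglongrightarrow> sqrt pi / (2 * sqrt t)"
proof -
  let ?f = "\<lambda>x::real. exp (- t * x\<^sup>2)"
  have integrable: "set_integrable lborel {0..} ?f"
    and integral_eq: "(LINT x:{0..}|lborel. ?f x) = sqrt pi / (2 * sqrt t)"
    using gaussian_half_line[OF assms]
    by (auto simp: has_bochner_integral_iff set_integrable_def set_lebesgue_integral_def)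
  have "((\<lambda>b. LINT x:{0..b}|lborel. ?f x) \<longlongrightarrow> sqrt pi / (2 * sqrt t)) at_top"
    unfolding integral_eq[symmetric]
    by (rule tendsto_set_lebesgue_integral_at_top[OF _ integrable]) auto
  moreover have "(LINT x:{0..b}|lborel. ?f x) = integral {0..b} ?f" for b
    by (rule set_borel_integral_eq_integral(2), rule set_integrable_subset[OF integrable]) auto
  ultimately have "((\<lambda>b. integral {0..b} ?f) \<longlongrightarrow> sqrt pi / (2 * sqrt t)) at_top"
    by simp
  then show ?thesis by (rule filterlim_compose[OF _ filterlim_real_sequentially])
qed

lemma gaussian_sum_bounds:
  fixes t :: real
  assumes t: "t > 0"
  shows "summable (\<lambda>n. exp (- t * real (Suc n) ^ 2))"
    and "sqrt pi / (2 * sqrt t) - 1 \<le> (\<Sum>n. exp (- t * real (Suc n) ^ 2))"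
    and "(\<Sum>n. exp (- t * real (Suc n) ^ 2)) \<le> sqrt pi / (2 * sqrt t)"
proof -
  interpret antimono_fun_sum_integral_diff "\<lambda>x. exp (- t * x\<^sup>2)"
    by unfold_locales (use t in \<open>auto intro!: continuous_intros power_mono\<close>)
  note bounds = suminf_integral_bounds[OF gaussian_integral_tendsto[OF t]]
  show "summable (\<lambda>n. exp (- t * real (Suc n) ^ 2))"
    by (rule summable_Suc_iff[THEN iffD2, OF bounds(1)])
  have "(\<Sum>n. exp (- t * real (Suc n) ^ 2)) = (\<Sum>n. exp (- t * real n ^ 2)) - 1"
    using suminf_split_head[OF bounds(1)] by simp
  then show "sqrt pi / (2 * sqrt t) - 1 \<le> (\<Sum>n. exp (- t * real (Suc n) ^ 2))"
    and "(\<Sum>n. exp (- t * real (Suc n) ^ 2)) \<le> sqrt pi / (2 * sqrt t)"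
    using bounds(2,3) by simp_all
qed

definition theta :: "real \<Rightarrow> real" where
  "theta t = (\<Sum>n. exp (- t * (real (Suc n) ^ 2 - 1)))"

lemma theta_term_eq: "exp (- t * (real (Suc n) ^ 2 - 1)) = exp t * exp (- t * real (Suc n) ^ 2)"
  by (simp add: algebra_simps flip: exp_add)

lemma theta_sums:
  assumes "t > 0"
  shows "(\<lambda>n. exp (- t * (real (Suc n) ^ 2 - 1))) sums theta t"
  unfolding theta_def theta_term_eq
  by (intro summable_sums summable_mult gaussian_sum_bounds(1) assms)

lemma theta_has_sum:
  assumes "t > 0"
  shows "((\<lambda>n. exp (- t * (real n ^ 2 - 1))) has_sum theta t) {1..}"
proof -
  have "((\<lambda>n. exp (- t * (real (Suc n) ^ 2 - 1))) has_sum theta t) UNIV"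
    by (rule sums_nonneg_imp_has_sum[OF theta_sums[OF assms]]) simp
  moreover have "bij_betw Suc UNIV {1..}"
    by (rule bij_betwI[where g = "\<lambda>n. n - 1"]) auto
  ultimately show ?thesis
    using has_sum_reindex_bij_betw[of Suc UNIV "{1..}" "\<lambda>n. exp (- t * (real n ^ 2 - 1))"] by simp
qed

lemma theta_gaussian_bounds:
  assumes t: "t > 0"
  shows "exp t * (sqrt pi / (2 * sqrt t) - 1) \<le> theta t"
    and "theta t \<le> exp t * (sqrt pi / (2 * sqrt t))"
proof -
  have eq: "theta t = exp t * (\<Sum>n. exp (- t * real (Suc n) ^ 2))"
    unfolding theta_def theta_term_eq by (rule suminf_mult[OF gaussian_sum_bounds(1)[OF t]])
  show "exp t * (sqrt pi / (2 * sqrt t) - 1) \<le> theta t"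
    unfolding eq by (intro mult_left_mono gaussian_sum_bounds(2) t) simp
  show "theta t \<le> exp t * (sqrt pi / (2 * sqrt t))"
    unfolding eq by (intro mult_left_mono gaussian_sum_bounds(3) t) simp
qed

lemma theta_minus_one_sums:
  assumes "t > 0"
  shows "(\<lambda>n. exp (- t * (real (Suc (Suc n)) ^ 2 - 1))) sums (theta t - 1)"
  using theta_sums[OF assms] by (subst sums_Suc_iff) simp

lemma theta_ge_1:
  assumes "t > 0"
  shows "1 \<le> theta t"
  using sums_le[OF _ sums_zero theta_minus_one_sums[OF assms]] by simp

lemma theta_minus_one_le:
  assumes t: "t > 0"
  shows "theta t - 1 \<le> exp (- 2 * t) * (sqrt pi / (2 * sqrt t))"
proof -
  have "theta t - 1 \<le> exp (- 2 * t) * (\<Sum>n. exp (- t * real (Suc n) ^ 2))"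
  proof (rule sums_le[OF _ theta_minus_one_sums[OF t]
        sums_mult[OF summable_sums[OF gaussian_sum_bounds(1)[OF t]]]])
    fix n
    have "t * (2 + real (Suc n) ^ 2) \<le> t * (real (Suc (Suc n)) ^ 2 - 1)"
      using t by (intro mult_left_mono) (auto simp: power2_eq_square algebra_simps)
    then show "exp (- t * (real (Suc (Suc n)) ^ 2 - 1))
        \<le> exp (- 2 * t) * exp (- t * real (Suc n) ^ 2)"
      by (simp add: algebra_simps flip: exp_add)
  qed
  also have "\<dots> \<le> exp (- 2 * t) * (sqrt pi / (2 * sqrt t))"
    by (intro mult_left_mono gaussian_sum_bounds(3) t) simp
  finally show ?thesis .
qed

lemma powr_le_exp:
  fixes t q :: real
  assumes "t > 0" "q \<ge> 0"
  shows "t powr q \<le> (q + 1) powr q * exp t"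
proof -
  have "q * ln (t / (q + 1)) \<le> q * (t / (q + 1))"
    using assms by (intro mult_left_mono ln_bound) auto
  also have "\<dots> \<le> t" using assms by (simp add: field_simps)
  finally have "q * ln t \<le> q * ln (q + 1) + t"
    using assms by (simp add: ln_div algebra_simps)
  then have "exp (q * ln t) \<le> exp (q * ln (q + 1) + t)" by simp
  then show ?thesis using assms by (simp add: powr_def exp_add)
qed

lemma theta_minus_one_le_powr:
  fixes p :: real
  assumes p: "p \<ge> 1/2"
  obtains C where "C \<ge> 0" "\<And>t. t > 0 \<Longrightarrow> theta t - 1 \<le> C * t powr (- p)"
proof
  define q where "q = p - 1/2"
  show "0 \<le> (q + 1) powr q * (sqrt pi / 2)" by simp
  fix t :: real assume t: "t > 0"
  have "theta t - 1 \<le> exp (- 2 * t) * (sqrt pi / (2 * sqrt t))"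
    by (rule theta_minus_one_le[OF t])
  also have "\<dots> \<le> (q + 1) powr q * t powr (- q) * (sqrt pi / (2 * sqrt t))"
  proof (rule mult_right_mono)
    have "exp (- 2 * t) \<le> exp (- t)" using t by simp
    also have "\<dots> \<le> (q + 1) powr q * t powr (- q)"
      using powr_le_exp[OF t, of q] t p by (simp add: q_def powr_minus exp_minus field_simps)
    finally show "exp (- 2 * t) \<le> (q + 1) powr q * t powr (- q)" .
  qed (use t in simp)
  also have "\<dots> = (q + 1) powr q * (sqrt pi / 2) * (t powr (- q) * t powr (- (1/2)))"
    using t by (simp add: powr_minus powr_half_sqrt field_simps)
  also have "t powr (- q) * t powr (- (1/2)) = t powr (- p)"
    by (simp add: q_def flip: powr_add)
  finally show "theta t - 1 \<le> (q + 1) powr q * (sqrt pi / 2) * t powr (- p)" .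
qed

lemma sqrt_mult_theta_tendsto: "((\<lambda>t. sqrt t * theta t) \<longlongrightarrow> sqrt pi / 2) (at_right 0)"
proof (rule tendsto_sandwich)
  have pos: "eventually (\<lambda>t::real. t > 0) (at_right 0)"
    by (rule eventually_at_right_less)
  show "eventually (\<lambda>t. exp t * (sqrt pi / 2 - sqrt t) \<le> sqrt t * theta t) (at_right 0)"
    using pos
  proof eventually_elim
    case (elim t)
    have "exp t * (sqrt pi / 2 - sqrt t) = sqrt t * (exp t * (sqrt pi / (2 * sqrt t) - 1))"
      using elim by (simp add: field_simps)
    also have "\<dots> \<le> sqrt t * theta t"
      using elim by (intro mult_left_mono theta_gaussian_bounds(1)) auto
    finally show ?case .
  qed
  show "eventually (\<lambda>t. sqrt t * theta t \<le> exp t * (sqrt pi / 2)) (at_right 0)"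
    using pos
  proof eventually_elim
    case (elim t)
    have "sqrt t * theta t \<le> sqrt t * (exp t * (sqrt pi / (2 * sqrt t)))"
      using elim by (intro mult_left_mono theta_gaussian_bounds(2)) auto
    also have "\<dots> = exp t * (sqrt pi / 2)"
      using elim by (simp add: field_simps)
    finally show ?case .
  qed
  show "((\<lambda>t. exp t * (sqrt pi / 2 - sqrt t)) \<longlongrightarrow> sqrt pi / 2) (at_right (0::real))"
    by (rule tendsto_eq_intros refl | simp)+
  show "((\<lambda>t. exp t * (sqrt pi / 2)) \<longlongrightarrow> sqrt pi / 2) (at_right (0::real))"
    by (rule tendsto_eq_intros refl | simp)+
qed

section \<open>The critical density\<close>

lemma gamma_integral_half_line:
  fixes s z :: real
  assumes s: "s > 0" and z: "z > 0"
  shows "has_bochner_integral lborel (\<lambda>x. indicator {0<..} x *\<^sub>R (x powr (z - 1) * exp (- s * x)))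
    (Gamma z * s powr (- z))"
proof -
  let ?f = "\<lambda>t. indicator {0..} t * t powr (z - 1) / exp t"
  have "has_bochner_integral lborel ?f (Gamma z)"
    using z Gamma_real_pos[OF z]
    by (intro has_bochner_integral_nn_integral)
       (auto simp: Gamma_conv_nn_integral_real indicator_def less_imp_le)
  then have "has_bochner_integral lborel (\<lambda>x. ?f (0 + s * x)) (Gamma z /\<^sub>R \<bar>s\<bar>)"
    using s by (subst lborel_has_bochner_integral_real_affine_iff[symmetric]) auto
  then have "has_bochner_integral lborel (\<lambda>x. s powr (1 - z) * ?f (0 + s * x))
      (s powr (1 - z) * (Gamma z /\<^sub>R \<bar>s\<bar>))"
    by (rule has_bochner_integral_mult_right)
  moreover have "s powr (1 - z) * ?f (0 + s * x)
      = indicator {0<..} x *\<^sub>R (x powr (z - 1) * exp (- s * x))" for x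
  proof (cases "x > 0")
    case True
    have "s powr (1 - z) * s powr (z - 1) = 1" using s by (simp flip: powr_add)
    then show ?thesis using True s by (simp add: powr_mult exp_minus field_simps)
  next
    case False
    then show ?thesis using s by (auto simp: indicator_def zero_le_mult_iff)
  qed
  moreover have "s powr (1 - z) * (Gamma z /\<^sub>R \<bar>s\<bar>) = Gamma z * s powr (- z)"
    using s by (simp add: powr_diff powr_minus field_simps)
  ultimately show ?thesis by (simp only:)
qed

lemma summable_scaled_powr:
  fixes c z :: real
  assumes "c > 0" "z > 1"
  shows "summable (\<lambda>j. (c * real (Suc j)) powr (- z))"
proof -
  have "summable (\<lambda>j. real (Suc j) powr (- z))"
    using assms by (subst summable_Suc_iff) (simp add: summable_real_powr_iff)
  then have "summable (\<lambda>j. c powr (- z) * real (Suc j) powr (- z))"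
    by (rule summable_mult)
  then show ?thesis by (simp only: powr_mult)
qed

lemma bose_integrand_sums:
  fixes a x \<beta> :: real
  assumes "\<beta> > 0" "x > 0"
  shows "(\<lambda>j. a * exp (- (\<beta> * real (Suc j)) * x)) sums (a / (exp (\<beta> * x) - 1))"
proof -
  define z where "z = exp (- \<beta> * x)"
  have z: "0 < z" "z < 1" using assms by (auto simp: z_def)
  have "(\<lambda>j. a * z * z ^ j) sums (a * z * (1 / (1 - z)))"
    using z by (intro sums_mult geometric_sums) auto
  moreover have "exp (- (\<beta> * real (Suc j)) * x) = z * z ^ j" for j
    by (simp add: z_def algebra_simps flip: exp_of_nat_mult exp_add)
  moreover have "a * z * (1 / (1 - z)) = a / (exp (\<beta> * x) - 1)"
    using z by (simp add: z_def exp_minus field_simps)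
  ultimately show ?thesis by (simp only: mult.assoc)
qed

lemma bose_integral_sums:
  fixes z \<beta> :: real
  assumes \<beta>: "\<beta> > 0" and z: "z > 1"
  shows "(\<lambda>j. Gamma z * (\<beta> * real (Suc j)) powr (- z)) sums
    (LINT x:{0<..}|lborel. x powr (z - 1) / (exp (\<beta> * x) - 1))"
proof -
  define f where
    "f = (\<lambda>j (x::real). indicator {0<..} x *\<^sub>R (x powr (z - 1) * exp (- (\<beta> * real (Suc j)) * x)))"
  have f: "has_bochner_integral lborel (f j) (Gamma z * (\<beta> * real (Suc j)) powr (- z))" for j
    unfolding f_def using \<beta> z by (intro gamma_integral_half_line) auto
  have nonneg: "norm (f j x) = f j x" for j x
    by (auto simp: f_def indicator_def)
  have pointwise: "(\<lambda>j. f j x) sums (indicator {0<..} x *\<^sub>R (x powr (z - 1) / (exp (\<beta> * x) - 1)))"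
    for x
    using bose_integrand_sums[OF \<beta>, of x "x powr (z - 1)"]
    by (cases "x > 0") (auto simp: f_def)
  have "(\<lambda>j. integral\<^sup>L lborel (f j)) sums (\<integral>x. (\<Sum>j. f j x) \<partial>lborel)"
  proof (rule sums_integral)
    show "integrable lborel (f j)" for j
      using f by (auto simp: has_bochner_integral_iff)
    show "AE x in lborel. summable (\<lambda>j. norm (f j x))"
      using pointwise by (simp only: nonneg) (auto simp: sums_iff)
    show "summable (\<lambda>j. \<integral>x. norm (f j x) \<partial>lborel)"
      using f summable_mult[OF summable_scaled_powr[OF \<beta> z], of "Gamma z"]
      by (simp only: nonneg has_bochner_integral_iff)
  qed
  then show ?thesis
    using f sums_unique[OF pointwise]
    by (simp add: has_bochner_integral_iff set_lebesgue_integral_def)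
qed

lemma Gamma_three_halves: "Gamma (3/2 :: real) = sqrt pi / 2"
proof -
  have "(1/2 :: real) \<notin> \<int>\<^sub>\<le>\<^sub>0" by (auto dest: nonpos_Ints_nonpos)
  then show ?thesis using Gamma_plus1[of "1/2 :: real"] by (simp add: Gamma_one_half_real)
qed

lemma powr_minus_three_halves:
  fixes x :: real
  assumes "x > 0"
  shows "x powr (- (3/2)) = sqrt x / x ^ 2"
proof -
  have "x powr (- (3/2)) = x powr (1/2) * x powr (-2)"
    by (subst powr_add[symmetric]) simp
  then show ?thesis using assms by (simp add: powr_half_sqrt powr_minus field_simps)
qed

lemma rho_c_sums:
  assumes "\<beta> > 0"
  shows "(\<lambda>j. (2 * pi * (\<beta> * real (Suc j))) powr (- (3/2))) sums rho_c \<beta>"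
proof -
  define K where "K = sqrt 2 / (3 * pi ^ 2) * (3/2)"
  have "(\<lambda>j. K * (Gamma (3/2) * (\<beta> * real (Suc j)) powr (- (3/2)))) sums
      (K * (LINT x:{0<..}|lborel. x powr (3/2 - 1) / (exp (\<beta> * x) - 1)))"
    by (intro sums_mult bose_integral_sums assms) simp
  moreover have "K * (Gamma (3/2) * (\<beta> * real (Suc j)) powr (- (3/2)))
      = (2 * pi * (\<beta> * real (Suc j))) powr (- (3/2))" for j
  proof -
    have "K * Gamma (3/2) = (2 * pi) powr (- (3/2))"
      by (simp add: K_def Gamma_three_halves powr_minus_three_halves power2_eq_square
          real_sqrt_mult)
    then show ?thesis by (simp add: powr_mult[of "2 * pi"])
  qed
  moreover have "K * (LINT x:{0<..}|lborel. x powr (3/2 - 1) / (exp (\<beta> * x) - 1)) = rho_c \<beta>"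
    unfolding rho_c_def set_integral_mult_right[symmetric]
    by (rule set_lebesgue_integral_cong) (auto simp: Fdens_def K_def powr_half_sqrt)
  ultimately show ?thesis by simp
qed

lemma rho_c_nonneg:
  assumes "\<beta> > 0"
  shows "0 \<le> rho_c \<beta>"
  by (rule sums_le[OF _ sums_zero rho_c_sums[OF assms]]) simp

section \<open>Dirichlet boxes\<close>

definition excitation_energy :: "real \<Rightarrow> real \<Rightarrow> real \<Rightarrow> real \<Rightarrow> mode \<Rightarrow> real" where
  "excitation_energy a1 a2 a3 V k = eps a1 a2 a3 V k - eps a1 a2 a3 V (1, 1, 1)"

lemma occ_can_excitation_energy:
  "occ_can \<beta> (excitation_energy a1 a2 a3 V) N k = occ_can \<beta> (eps a1 a2 a3 V) N k"
  unfolding excitation_energy_def[abs_def] by (rule occ_can_shift)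

lemma excitation_energy_eq:
  "excitation_energy a1 a2 a3 V (n1, n2, n3) = pi ^ 2 / 2 * ((real n1 ^ 2 - 1) * V powr (-2 * a1)
     + (real n2 ^ 2 - 1) * V powr (-2 * a2) + (real n3 ^ 2 - 1) * V powr (-2 * a3))"
  by (simp add: excitation_energy_def eps_def algebra_simps)

text \<open>The partition functions at inverse temperature \<open>t\<close> of a particle in an interval of length
  \<open>V powr a\<close>, relative to the ground state, and of the excited states of a particle in the box.\<close>
definition interval_theta :: "real \<Rightarrow> real \<Rightarrow> real \<Rightarrow> real" where
  "interval_theta a V t = theta (pi ^ 2 / 2 * t * V powr (-2 * a))"

definition excited_partition :: "real \<Rightarrow> real \<Rightarrow> real \<Rightarrow> real \<Rightarrow> real \<Rightarrow> real" where
  "excited_partition a1 a2 a3 V t =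
     interval_theta a1 V t * (interval_theta a2 V t * interval_theta a3 V t) - 1"

lemma interval_theta_ge_1: "V > 0 \<Longrightarrow> t > 0 \<Longrightarrow> 1 \<le> interval_theta a V t"
  unfolding interval_theta_def by (intro theta_ge_1) simp

lemma excited_partition_nonneg:
  assumes "V > 0" "t > 0"
  shows "0 \<le> excited_partition a1 a2 a3 V t"
proof -
  have "1 * (1 * 1) \<le> interval_theta a1 V t * (interval_theta a2 V t * interval_theta a3 V t)"
    using interval_theta_ge_1[OF assms] order_trans[OF zero_le_one interval_theta_ge_1[OF assms]]
    by (intro mult_mono mult_nonneg_nonneg) auto
  then show ?thesis by (simp add: excited_partition_def)
qed

lemma excitation_factor_has_sum:
  assumes "V > 0" "t > 0"
  shows "((\<lambda>k. exp (- t * excitation_energy a1 a2 a3 V k)) has_sum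
    (1 + excited_partition a1 a2 a3 V t)) modes"
proof -
  define f where "f = (\<lambda>a n. exp (- (pi ^ 2 / 2 * t * V powr (-2 * a)) * (real n ^ 2 - 1)))"
  have f: "(f a has_sum interval_theta a V t) {1..}" for a
    unfolding f_def interval_theta_def using assms by (intro theta_has_sum) simp
  have nonneg: "f a n \<ge> 0" for a n by (simp add: f_def)
  have "((\<lambda>(n1, p). f a1 n1 * (case p of (n2, n3) \<Rightarrow> f a2 n2 * f a3 n3)) has_sum
      (1 + excited_partition a1 a2 a3 V t)) ({1..} \<times> {1..} \<times> {1..})"
    unfolding excited_partition_def add_diff_cancel_left' diff_add_cancel add.commute[of 1]
    by (intro has_sum_product_nonneg f) (auto simp: nonneg)
  moreover have "modes = {1..} \<times> {1..} \<times> {1..}" by (auto simp: modes_def)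
  moreover have "(\<lambda>(n1, p). f a1 n1 * (case p of (n2, n3) \<Rightarrow> f a2 n2 * f a3 n3))
      = (\<lambda>k. exp (- t * excitation_energy a1 a2 a3 V k))"
  proof (rule ext, clarify)
    fix n1 n2 n3
    show "f a1 n1 * (f a2 n2 * f a3 n3) = exp (- t * excitation_energy a1 a2 a3 V (n1, n2, n3))"
      unfolding f_def exp_add[symmetric] excitation_energy_eq by (simp add: field_simps)
  qed
  ultimately show ?thesis by simp
qed

lemma excited_power_sum_excitation_energy:
  assumes "V > 0" "\<beta> > 0"
  shows "excited_power_sum \<beta> (excitation_energy a1 a2 a3 V) (1, 1, 1) j
    = excited_partition a1 a2 a3 V (\<beta> * real (Suc j))"
proof -
  have power: "exp (- (\<beta> * real (Suc j)) * x) = exp (- \<beta> * x) ^ Suc j" for x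
    by (simp only: exp_of_nat_mult[symmetric]) (simp add: mult_ac)
  let ?f = "\<lambda>k. exp (- \<beta> * excitation_energy a1 a2 a3 V k) ^ Suc j"
  have "(?f has_sum (1 + excited_partition a1 a2 a3 V (\<beta> * real (Suc j)))) modes"
    using excitation_factor_has_sum[of V "\<beta> * real (Suc j)" a1 a2 a3] assms
    by (simp only: power) simp
  moreover have "(?f has_sum 1) {(1, 1, 1)}"
    by (intro has_sum_finiteI) (auto simp: excitation_energy_def)
  ultimately have "(?f has_sum (1 + excited_partition a1 a2 a3 V (\<beta> * real (Suc j)) - 1))
      (modes - {(1, 1, 1)})"
    by (rule has_sum_Diff) (simp add: modes_def)
  then show ?thesis unfolding excited_power_sum_def by (simp add: infsumI)
qed

lemma interval_theta_tendsto:
  assumes "a > 0" "t > 0"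
  shows "((\<lambda>V. V powr (- a) * interval_theta a V t) \<longlongrightarrow> (2 * pi * t) powr (- (1/2))) at_top"
proof -
  define c where "c = pi ^ 2 / 2 * t"
  have c: "c > 0" using assms by (simp add: c_def)
  have "filterlim (\<lambda>V. c * V powr (-2 * a)) (at_right 0) at_top"
    using c assms by real_asymp
  then have "((\<lambda>V. sqrt (c * V powr (-2 * a)) * theta (c * V powr (-2 * a)) / sqrt c)
      \<longlongrightarrow> (sqrt pi / 2) / sqrt c) at_top"
    using c
    by (intro tendsto_divide tendsto_const filterlim_compose[OF sqrt_mult_theta_tendsto]) auto
  moreover have "eventually (\<lambda>V. sqrt (c * V powr (-2 * a)) * theta (c * V powr (-2 * a)) / sqrt c
      = V powr (- a) * interval_theta a V t) at_top"
    using eventually_gt_at_top[of "0::real"]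
  proof eventually_elim
    case (elim V)
    have "sqrt (V powr (-2 * a)) = V powr (- a)"
      using elim by (simp add: powr_powr flip: powr_half_sqrt)
    moreover have "interval_theta a V t = theta (c * V powr (-2 * a))"
      by (simp add: interval_theta_def c_def)
    ultimately show ?case using c by (simp add: real_sqrt_mult)
  qed
  moreover have "(sqrt pi / 2) / sqrt c = (2 * pi * t) powr (- (1/2))"
  proof -
    have "(sqrt pi / 2) / sqrt c = 1 / sqrt (c * 4 / pi)"
      by (simp add: real_sqrt_mult real_sqrt_divide)
    also have "c * 4 / pi = 2 * pi * t" by (simp add: c_def power2_eq_square)
    finally show ?thesis using assms by (simp add: powr_minus powr_half_sqrt field_simps)
  qed
  ultimately show ?thesis by (simp add: tendsto_cong)
qed

lemma interval_theta_minus_one_le: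
  assumes "p \<ge> 1/2"
  obtains C where "C \<ge> 0"
    "\<And>V t a. V > 0 \<Longrightarrow> t > 0 \<Longrightarrow> interval_theta a V t - 1 \<le> C * t powr (- p) * V powr (2 * a * p)"
proof -
  obtain C where C: "C \<ge> 0" "\<And>t. t > 0 \<Longrightarrow> theta t - 1 \<le> C * t powr (- p)"
    using theta_minus_one_le_powr[OF assms] by blast
  show thesis
  proof
    show "0 \<le> C * (pi ^ 2 / 2) powr (- p)" using C(1) by simp
    fix V t a :: real assume pos: "V > 0" "t > 0"
    have "(pi ^ 2 / 2 * t * V powr (-2 * a)) powr (- p)
        = (pi ^ 2 / 2) powr (- p) * t powr (- p) * V powr (2 * a * p)"
      by (simp only: powr_mult) (simp add: powr_powr)
    then show "interval_theta a V t - 1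
        \<le> C * (pi ^ 2 / 2) powr (- p) * t powr (- p) * V powr (2 * a * p)"
      using C(2)[of "pi ^ 2 / 2 * t * V powr (-2 * a)"] pos
      by (simp add: interval_theta_def mult.assoc)
  qed
qed

locale box_exponents =
  fixes a1 a2 a3 :: real
  assumes decreasing: "a1 \<ge> a2" "a2 \<ge> a3"
    and smallest_pos: "a3 > 0"
    and sum_eq_1: "a1 + a2 + a3 = 1"
begin

lemma exponents_pos: "a1 > 0" "a2 > 0"
  using decreasing smallest_pos by auto

lemma powr_exponents_mult:
  assumes "V > 0"
  shows "V powr a1 * (V powr a2 * V powr a3) = V"
  using assms sum_eq_1 by (simp add: add.assoc flip: powr_add)

lemma spectral_gap:
  assumes "V \<ge> 1" "k \<in> modes" "k \<noteq> (1, 1, 1)"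
  shows "V powr (-2 * a1) \<le> excitation_energy a1 a2 a3 V k"
proof -
  have longest: "V powr (-2 * a1) \<le> V powr (-2 * a)" if "a \<le> a1" for a
    using assms(1) that by (intro powr_mono) auto
  obtain n1 n2 n3 where k: "k = (n1, n2, n3)" by (cases k)
  define d where "d = (\<lambda>n::nat. real n ^ 2 - 1)"
  have d_nonneg: "d n1 \<ge> 0" "d n2 \<ge> 0" "d n3 \<ge> 0"
    using assms(2) by (auto simp: k d_def modes_def)
  have "1 \<le> d n" if "n \<ge> 2" for n
    using power_mono[of 2 "real n" 2] that by (simp add: d_def)
  moreover have "n1 \<ge> 2 \<or> n2 \<ge> 2 \<or> n3 \<ge> 2"
    using assms(2,3) by (auto simp: k modes_def)
  ultimately have "1 \<le> d n1 + d n2 + d n3"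
    using d_nonneg by fastforce
  moreover have "1 \<le> pi ^ 2 / 2"
    using power_mono[OF pi_ge_two, of 2] by simp
  ultimately have "1 * (1 * V powr (-2 * a1))
      \<le> pi ^ 2 / 2 * ((d n1 + d n2 + d n3) * V powr (-2 * a1))"
    by (intro mult_mono) auto
  also have "(d n1 + d n2 + d n3) * V powr (-2 * a1)
      \<le> d n1 * V powr (-2 * a1) + d n2 * V powr (-2 * a2) + d n3 * V powr (-2 * a3)"
    unfolding distrib_right using decreasing
    by (intro add_mono mult_left_mono longest d_nonneg) auto
  also have "pi ^ 2 / 2 * \<dots> = excitation_energy a1 a2 a3 V k"
    by (simp add: k d_def excitation_energy_eq)
  finally show ?thesis by (simp add: mult_left_mono)
qed

lemma gapped_bose_gas_box:
  assumes "V \<ge> 1" "\<beta> > 0"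
  shows "gapped_bose_gas \<beta> (excitation_energy a1 a2 a3 V) (1, 1, 1) (\<beta> * V powr (-2 * a1))"
proof
  show "(\<lambda>k. exp (- \<beta> * excitation_energy a1 a2 a3 V k)) summable_on modes"
    using assms by (intro has_sum_imp_summable[OF excitation_factor_has_sum]) auto
  show "\<beta> * V powr (-2 * a1) \<le> \<beta> * excitation_energy a1 a2 a3 V k"
    if "k \<in> modes" "k \<noteq> (1, 1, 1)" for k
    using spectral_gap[OF assms(1) that] assms(2) by (intro mult_left_mono) auto
qed (use assms in \<open>auto simp: modes_def excitation_energy_def\<close>)

lemma excited_partition_tendsto:
  assumes t: "t > 0"
  shows "((\<lambda>V. excited_partition a1 a2 a3 V t / V) \<longlongrightarrow> (2 * pi * t) powr (- (3/2))) at_top"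
proof -
  let ?h = "\<lambda>a V. V powr (- a) * interval_theta a V t" and ?l = "(2 * pi * t) powr (- (1/2))"
  have "((\<lambda>V. ?h a1 V * (?h a2 V * ?h a3 V) - 1 / V) \<longlongrightarrow> ?l * (?l * ?l) - 0) at_top"
    by (intro tendsto_diff tendsto_mult interval_theta_tendsto exponents_pos smallest_pos t)
       real_asymp
  moreover have "?l * (?l * ?l) - 0 = (2 * pi * t) powr (- (3/2))"
    by (simp only: powr_add[symmetric] diff_zero) simp
  moreover have "eventually (\<lambda>V. ?h a1 V * (?h a2 V * ?h a3 V) - 1 / V
      = excited_partition a1 a2 a3 V t / V) at_top"
    using eventually_gt_at_top[of "0::real"]
  proof eventually_elim
    case (elim V)
    have "V powr (- a1) * (V powr (- a2) * V powr (- a3))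
        = inverse (V powr a1 * (V powr a2 * V powr a3))"
      by (simp add: powr_minus)
    also have "\<dots> = 1 / V"
      by (simp only: powr_exponents_mult[OF elim] inverse_eq_divide)
    finally have volume: "V powr (- a1) * (V powr (- a2) * V powr (- a3)) = 1 / V" .
    have "?h a1 V * (?h a2 V * ?h a3 V) = (V powr (- a1) * (V powr (- a2) * V powr (- a3)))
        * (interval_theta a1 V t * (interval_theta a2 V t * interval_theta a3 V t))"
      by (simp only: mult_ac)
    then show ?case by (simp add: volume excited_partition_def diff_divide_distrib)
  qed
  ultimately show ?thesis by (simp add: tendsto_cong)
qed

lemma interval_theta_minus_one_le_longest:
  assumes "p \<ge> 1/2"
  obtains C where "C \<ge> 0"
    "\<And>V t a. V \<ge> 1 \<Longrightarrow> t > 0 \<Longrightarrow> a \<le> a1 \<Longrightarrow>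
       interval_theta a V t - 1 \<le> C * t powr (- p) * V powr (2 * a1 * p)"
proof -
  obtain C where C: "C \<ge> 0" "\<And>V t a. V > 0 \<Longrightarrow> t > 0 \<Longrightarrow>
      interval_theta a V t - 1 \<le> C * t powr (- p) * V powr (2 * a * p)"
    using interval_theta_minus_one_le[OF assms] by blast
  show thesis
  proof (rule that[OF C(1)])
    fix V t a :: real assume V: "V \<ge> 1" and t: "t > 0" and a: "a \<le> a1"
    have "interval_theta a V t - 1 \<le> C * t powr (- p) * V powr (2 * a * p)"
      using C(2) V t by simp
    also have "\<dots> \<le> C * t powr (- p) * V powr (2 * a1 * p)"
      using V a assms C(1) by (intro mult_left_mono powr_mono mult_right_mono) auto
    finally show "interval_theta a V t - 1 \<le> C * t powr (- p) * V powr (2 * a1 * p)" .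
  qed
qed

lemma one_excited_direction_le:
  assumes "a1 < 1/2"
  obtains C where "C \<ge> 0"
    "\<And>V t a. V \<ge> 1 \<Longrightarrow> t > 0 \<Longrightarrow> a \<le> a1 \<Longrightarrow>
       interval_theta a V t - 1 \<le> C * t powr (- (1 / (2 * a1))) * V"
proof -
  have "1 / (2 * a1) \<ge> 1/2" using assms exponents_pos by (simp add: field_simps)
  then obtain C where C: "C \<ge> 0" "\<And>V t a. V \<ge> 1 \<Longrightarrow> t > 0 \<Longrightarrow> a \<le> a1 \<Longrightarrow>
      interval_theta a V t - 1 \<le> C * t powr (- (1 / (2 * a1))) * V powr (2 * a1 * (1 / (2 * a1)))"
    using interval_theta_minus_one_le_longest by blast
  show thesis
    by (rule that[OF C(1)]) (use C(2) exponents_pos in fastforce)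
qed

lemma two_excited_directions_le:
  assumes "a1 < 1/2"
  obtains C where "C \<ge> 0"
    "\<And>V t a b. V \<ge> 1 \<Longrightarrow> t > 0 \<Longrightarrow> a \<le> a1 \<Longrightarrow> b \<le> a1 \<Longrightarrow>
       (interval_theta a V t - 1) * (interval_theta b V t - 1) \<le> C * t powr (- (1 / (2 * a1))) * V"
proof -
  let ?p = "1 / (4 * a1)"
  have "?p \<ge> 1/2" using assms exponents_pos by (simp add: field_simps)
  then obtain C where C: "C \<ge> 0" "\<And>V t a. V \<ge> 1 \<Longrightarrow> t > 0 \<Longrightarrow> a \<le> a1 \<Longrightarrow>
      interval_theta a V t - 1 \<le> C * t powr (- ?p) * V powr (2 * a1 * ?p)"
    using interval_theta_minus_one_le_longest by blast
  show thesis
  proof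
    show "0 \<le> C * C" by simp
    fix V t a b :: real assume V: "V \<ge> 1" and t: "t > 0" and ab: "a \<le> a1" "b \<le> a1"
    have "(interval_theta a V t - 1) * (interval_theta b V t - 1)
        \<le> (C * t powr (- ?p) * V powr (2 * a1 * ?p)) * (C * t powr (- ?p) * V powr (2 * a1 * ?p))"
      using V t ab C interval_theta_ge_1[of V t] by (intro mult_mono) auto
    also have "\<dots> = C * C * (t powr (- ?p) * t powr (- ?p))
        * (V powr (2 * a1 * ?p) * V powr (2 * a1 * ?p))"
      by (simp only: mult_ac)
    also have "t powr (- ?p) * t powr (- ?p) = t powr (- (1 / (2 * a1)))"
      by (simp flip: powr_add)
    also have "V powr (2 * a1 * ?p) * V powr (2 * a1 * ?p) = V"
      using V exponents_pos by (simp flip: powr_add)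
    finally show "(interval_theta a V t - 1) * (interval_theta b V t - 1)
        \<le> C * C * t powr (- (1 / (2 * a1))) * V" .
  qed
qed

lemma three_excited_directions_le:
  obtains C where "C \<ge> 0"
    "\<And>V t. V \<ge> 1 \<Longrightarrow> t > 0 \<Longrightarrow>
       (interval_theta a1 V t - 1) * ((interval_theta a2 V t - 1) * (interval_theta a3 V t - 1))
         \<le> C * t powr (- (3/2)) * V"
proof -
  obtain C where C: "C \<ge> 0" "\<And>V t a. V > 0 \<Longrightarrow> t > 0 \<Longrightarrow>
      interval_theta a V t - 1 \<le> C * t powr (- (1/2)) * V powr (2 * a * (1/2))"
    using interval_theta_minus_one_le[of "1/2"] by auto
  show thesis
  proof
    show "0 \<le> C * (C * C)" using C(1) by simp
    fix V t :: real assume V: "V \<ge> 1" and t: "t > 0"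
    let ?u = "\<lambda>a. interval_theta a V t - 1" and ?x = "t powr (- (1/2))"
    have u: "0 \<le> ?u a" "?u a \<le> C * ?x * V powr a" for a
      using interval_theta_ge_1[of V t a] C(2)[of V t a] V t by auto
    have "?u a1 * (?u a2 * ?u a3)
        \<le> (C * ?x * V powr a1) * ((C * ?x * V powr a2) * (C * ?x * V powr a3))"
      using C(1) by (intro mult_mono u mult_nonneg_nonneg) auto
    also have "\<dots> = C * (C * C) * (?x * (?x * ?x)) * (V powr a1 * (V powr a2 * V powr a3))"
      by (simp only: mult_ac)
    also have "V powr a1 * (V powr a2 * V powr a3) = V"
      using V by (intro powr_exponents_mult) simp
    also have "?x * (?x * ?x) = t powr (- (3/2))"
      by (simp only: powr_add[symmetric]) simp
    finally show "?u a1 * (?u a2 * ?u a3) \<le> C * (C * C) * t powr (- (3/2)) * V" .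
  qed
qed

text \<open>States excited in all three directions decay like \<open>t powr (- 3/2)\<close> and carry exactly one power
  of \<open>V\<close>; for the others a faster decay in \<open>t\<close> is bought with powers of \<open>V\<close>, and \<open>a1 < 1/2\<close> ensures
  that one power of \<open>V\<close> buys an exponent larger than one.\<close>
lemma excited_partition_le:
  assumes "a1 < 1/2"
  obtains C where "\<And>V t. V \<ge> 1 \<Longrightarrow> t > 0 \<Longrightarrow>
    excited_partition a1 a2 a3 V t \<le> C * (t powr (- (3/2)) + t powr (- (1 / (2 * a1)))) * V"
proof -
  obtain C1 where one: "C1 \<ge> 0" "\<And>V t a. V \<ge> 1 \<Longrightarrow> t > 0 \<Longrightarrow> a \<le> a1 \<Longrightarrow>
      interval_theta a V t - 1 \<le> C1 * t powr (- (1 / (2 * a1))) * V"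
    using one_excited_direction_le[OF assms] by blast
  obtain C2 where two: "C2 \<ge> 0" "\<And>V t a b. V \<ge> 1 \<Longrightarrow> t > 0 \<Longrightarrow> a \<le> a1 \<Longrightarrow> b \<le> a1 \<Longrightarrow>
      (interval_theta a V t - 1) * (interval_theta b V t - 1) \<le> C2 * t powr (- (1 / (2 * a1))) * V"
    using two_excited_directions_le[OF assms] by blast
  obtain C3 where three: "C3 \<ge> 0" "\<And>V t. V \<ge> 1 \<Longrightarrow> t > 0 \<Longrightarrow>
      (interval_theta a1 V t - 1) * ((interval_theta a2 V t - 1) * (interval_theta a3 V t - 1))
        \<le> C3 * t powr (- (3/2)) * V"
    using three_excited_directions_le by blast
  show thesis
  proof
    fix V t :: real assume V: "V \<ge> 1" and t: "t > 0"
    let ?u = "\<lambda>a. interval_theta a V t - 1"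
    let ?x = "t powr (- (3/2))" and ?y = "t powr (- (1 / (2 * a1)))"
    have "excited_partition a1 a2 a3 V t = ?u a1 * (?u a2 * ?u a3)
        + (?u a1 * ?u a2 + ?u a1 * ?u a3 + ?u a2 * ?u a3) + (?u a1 + ?u a2 + ?u a3)"
      by (simp add: excited_partition_def algebra_simps)
    also have "\<dots> \<le> C3 * ?x * V + (C2 * ?y * V + C2 * ?y * V + C2 * ?y * V)
        + (C1 * ?y * V + C1 * ?y * V + C1 * ?y * V)"
      using V t decreasing by (intro add_mono one(2) two(2) three(2)) auto
    also have "\<dots> = (C3 * ?x + 3 * (C1 + C2) * ?y) * V"
      by (simp add: algebra_simps)
    also have "\<dots> \<le> (C3 + 3 * (C1 + C2)) * (?x + ?y) * V"
      using one(1) two(1) three(1) V by (intro mult_right_mono) (auto simp: algebra_simps)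
    finally show "excited_partition a1 a2 a3 V t \<le> (C3 + 3 * (C1 + C2)) * (?x + ?y) * V" .
  qed
qed

lemma excited_partition_dominated:
  assumes a1: "a1 < 1/2" and \<beta>: "\<beta> > 0"
  obtains M where "summable M"
    "\<And>V j. V \<ge> 1 \<Longrightarrow> norm (excited_partition a1 a2 a3 V (\<beta> * real (Suc j)) / V) \<le> M j"
proof -
  obtain C where C: "\<And>V t. V \<ge> 1 \<Longrightarrow> t > 0 \<Longrightarrow>
      excited_partition a1 a2 a3 V t \<le> C * (t powr (- (3/2)) + t powr (- (1 / (2 * a1)))) * V"
    using excited_partition_le[OF a1] by blast
  let ?t = "\<lambda>j. \<beta> * real (Suc j)"
  let ?M = "\<lambda>j. C * (?t j powr (- (3/2)) + ?t j powr (- (1 / (2 * a1))))"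
  show thesis
  proof
    show "summable ?M"
      using a1 \<beta> exponents_pos
      by (intro summable_mult summable_add summable_scaled_powr) (auto simp: field_simps)
    fix V :: real and j :: nat assume V: "V \<ge> 1"
    have "0 < \<beta> * real (Suc j)" using \<beta> by simp
    from C[OF V this] excited_partition_nonneg[OF _ this, of V a1 a2 a3] V
    show "norm (excited_partition a1 a2 a3 V (\<beta> * real (Suc j)) / V) \<le> ?M j"
      by (simp add: pos_divide_le_eq)
  qed
qed

lemma critical_number_tendsto:
  assumes a1: "a1 < 1/2" and \<beta>: "\<beta> > 0"
  shows "((\<lambda>V. critical_number \<beta> (excitation_energy a1 a2 a3 V) (1, 1, 1) / V) \<longlongrightarrow> rho_c \<beta>) at_top"
proof -
  define S where "S = (\<lambda>j V. excited_partition a1 a2 a3 V (\<beta> * real (Suc j)))"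
  obtain M where M: "summable M" "\<And>V j. V \<ge> 1 \<Longrightarrow> norm (S j V / V) \<le> M j"
    unfolding S_def using excited_partition_dominated[OF a1 \<beta>] by blast
  have limit: "((\<lambda>V. S j V / V) \<longlongrightarrow> (2 * pi * (\<beta> * real (Suc j))) powr (- (3/2))) at_top" for j
    unfolding S_def using \<beta> by (intro excited_partition_tendsto) simp
  have bound: "eventually (\<lambda>(j, V). norm (S j V / V) \<le> M j) (at_top \<times>\<^sub>F at_top)"
    unfolding eventually_prod_filter
    using M(2)
    by (intro exI[of _ "\<lambda>_. True"] exI[of _ "\<lambda>V. V \<ge> 1"]) (auto simp: eventually_ge_at_top)
  note tannery = tannerys_theorem[where a = "\<lambda>j V. S j V / V", OF limit bound M(1)
      trivial_limit_at_top_linorder]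
  have "eventually (\<lambda>V. (\<Sum>j. S j V / V)
      = critical_number \<beta> (excitation_energy a1 a2 a3 V) (1, 1, 1) / V) at_top"
    using conjunct1[OF tannery] eventually_gt_at_top[of "0::real"]
  proof eventually_elim
    case (elim V)
    have "summable (\<lambda>j. S j V)"
      using summable_mult[OF summable_norm_cancel[OF elim(1)], of V] elim(2) by simp
    moreover have "critical_number \<beta> (excitation_energy a1 a2 a3 V) (1, 1, 1) = (\<Sum>j. S j V)"
      unfolding critical_number_def S_def excited_power_sum_excitation_energy[OF elim(2) \<beta>] ..
    ultimately show ?case by (simp add: suminf_divide)
  qed
  then show ?thesis
    using tannery sums_unique[OF rho_c_sums[OF \<beta>]] by (simp add: tendsto_cong)
qed

end

theorem theorem3p14:
  fixes a1 a2 a3 \<beta> \<rho> :: real and n :: mode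
  assumes "a1 \<ge> a2" and "a2 \<ge> a3" and "a3 > 0" and "a1 + a2 + a3 = 1"
    and "a1 < 1/2" and "\<beta> > 0" and "\<rho> > rho_c \<beta>" and "n \<in> modes"
  shows "(\<lambda>N::nat. occ_can \<beta> (eps a1 a2 a3 (real N / \<rho>)) N n / (real N / \<rho>))
           \<longlonglongrightarrow> (if n = (1, 1, 1) then \<rho> - rho_c \<beta> else 0)"
proof -
  interpret box_exponents a1 a2 a3 by unfold_locales fact+
  let ?g = "(1, 1, 1) :: mode" and ?V = "\<lambda>N. real N / \<rho>"
  let ?e = "\<lambda>N. excitation_energy a1 a2 a3 (?V N)" and ?\<gamma> = "\<lambda>N. \<beta> * ?V N powr (-2 * a1)"
  have \<rho>: "\<rho> > 0" using rho_c_nonneg[OF \<open>\<beta> > 0\<close>] assms by simp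
  have volume: "filterlim ?V at_top sequentially" using \<rho> by real_asymp
  have density: "(\<lambda>N. real N / ?V N) \<longlonglongrightarrow> \<rho>" using \<rho> by real_asymp
  have gap: "(\<lambda>N. 1 / ?\<gamma> N / ?V N) \<longlonglongrightarrow> 0"
    using \<rho> \<open>\<beta> > 0\<close> \<open>a1 < 1/2\<close> exponents_pos by real_asymp
  have critical: "(\<lambda>N. critical_number \<beta> (?e N) ?g / ?V N) \<longlonglongrightarrow> rho_c \<beta>"
    using critical_number_tendsto[OF \<open>a1 < 1/2\<close> \<open>\<beta> > 0\<close>] volume by (rule filterlim_compose)
  have "eventually (\<lambda>N. ?V N \<ge> 1) sequentially"
    using volume by (simp add: filterlim_at_top)
  then have gas: "eventually (\<lambda>N. gapped_bose_gas \<beta> (?e N) ?g (?\<gamma> N)) sequentially"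
    by eventually_elim (rule gapped_bose_gas_box[OF _ \<open>\<beta> > 0\<close>])
  have "(\<lambda>N. occ_can \<beta> (?e N) N n / ?V N) \<longlonglongrightarrow> (if n = ?g then \<rho> - rho_c \<beta> else 0)"
    using ground_density_tendsto[OF gas volume density critical \<open>\<rho> > rho_c \<beta>\<close> gap]
      excited_density_tendsto[OF gas volume gap \<open>n \<in> modes\<close>] by simp
  then show ?thesis by (simp only: occ_can_excitation_energy)
qed

end
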